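(* Assume, in addition to the setting below, that at least one of the following holds: (H1) $f$ is differentiable on $\mathbb{R}^m$ with $L$-Lipschitz continuous gradient for some $L>0$; (H2) the restriction of $A$ to $\mathcal{M}(\Omega_0)$ is surjective onto $\mathbb{R}^m$. Then there is a subsequence of $(\mu_k,q_k)_{k\in\mathbb{N}}$ along which $\mu_k$ converges weak-$*$ (in $\mathcal{M}(\Omega)=\mathcal{C}_0(\Omega)^*$) to some $\mu_\infty$ and $q_k$ converges in $\mathbb{R}^m$ to some $q_\infty$, where $\mu_\infty$ solves $(\mathcal{P})$, $q_\infty$ solves $(\mathcal{D})$, and $J(\mu_k)\to J(\mu_\infty)=\inf(\mathcal{P})$ along this subsequence. If the solution of $(\mathcal{P})$ (respectively of $(\mathcal{D})$) is unique, then the whole sequence $(\mu_k)$ (respectively $(q_k)$) converges to it.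
   Context: Let $d,m\ge 1$ and let $\Omega\subseteq\mathbb{R}^d$ be a nonempty open set. $\mathcal{M}(\Omega)$ is the space of finite signed Radon measures on $\Omega$ with total variation norm $\|\cdot\|_{\mathcal{M}}$, identified with the dual of $\mathcal{C}_0(\Omega)$ (continuous functions vanishing at infinity, with sup-norm $\|\cdot\|_\infty$). For $\Omega'\subseteq\Omega$, $\mathcal{M}(\Omega')$ denotes the measures in $\mathcal{M}(\Omega)$ supported in $\Omega'$. Fix $a_1,\dots,a_m\in\mathcal{C}_0(\Omega)$; let $A:\mathcal{M}(\Omega)\to\mathbb{R}^m$, $(A\mu)_i=\int_\Omega a_i\,d\mu$, and for $q\in\mathbb{R}^m$ let $A^*q=\sum_{i=1}^m q_i a_i\in\mathcal{C}_0(\Omega)$. Let $f:\mathbb{R}^m\to\mathbb{R}\cup\{+\infty\}$ be proper, convex, lower semicontinuous and bounded from below, with convex conjugate $f^*(q)=\sup_{y}\langle q,y\rangle-f(y)$. Put $J(\mu)=\|\mu\|_{\mathcal{M}}+f(A\mu)$. For $\Omega'\subseteq\Omega$, $(\mathcal{P}(\Omega'))$ is the problem $\inf_{\mu\in\mathcal{M}(\Omega')}J(\mu)$ and $(\mathcal{D}(\Omega'))$ is $\sup\{-f^*(q):q\in\mathbb{R}^m,\ |A^*q(x)|\le 1\ \forall x\in\Omega'\}$; $(\mathcal{P})=(\mathcal{P}(\Omega))$ and $(\mathcal{D})=(\mathcal{D}(\Omega))$. Standing assumption: for $\Omega'=\Omega$ and for each $\Omega'=\Omega_k$ below, both problems admit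 solutions and their optimal values coincide (no duality gap). Exchange algorithm: a set $\Omega_0\subseteq\Omega$ is given; for $k\ge 0$, $\mu_k$ is a solution of $(\mathcal{P}(\Omega_k))$, $q_k$ a solution of $(\mathcal{D}(\Omega_k))$, $X_k$ is the set of all local maximizers $x\in\Omega$ of $|A^*q_k|$ with $|A^*q_k(x)|>1$, and $\Omega_{k+1}=\Omega_k\cup X_k$. *)

theory Defs
  imports "HOL-Analysis.Analysis" "HOL-Probability.Probability"
begin

(* A finite signed Radon (= finite signed Borel) measure on an open set \<Omega> of a
   Euclidean space, represented by its Jordan decomposition (mu_plus, mu_minus):
   two finite positive Borel measures on the ambient space, concentrated on \<Omega>,
   mutually singular.  This representation is unique, so equality of pairs is
   equality of signed measures. *)
type_synonym 'a smeasure = "'a measure \<times> 'a measure"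

definition is_smeasure :: "'a::euclidean_space set \<Rightarrow> 'a smeasure \<Rightarrow> bool" where
  "is_smeasure \<Omega> \<mu> \<longleftrightarrow>
     sets (fst \<mu>) = sets borel \<and> sets (snd \<mu>) = sets borel \<and>
     finite_measure (fst \<mu>) \<and> finite_measure (snd \<mu>) \<and>
     emeasure (fst \<mu>) (- \<Omega>) = 0 \<and> emeasure (snd \<mu>) (- \<Omega>) = 0 \<and>
     (\<exists>P \<in> sets borel. emeasure (fst \<mu>) (- P) = 0 \<and> emeasure (snd \<mu>) P = 0)"

definition tv_norm :: "'a::euclidean_space smeasure \<Rightarrow> real" where
  "tv_norm \<mu> = measure (fst \<mu>) UNIV + measure (snd \<mu>) UNIV"

definition sintegral :: "('a::euclidean_space \<Rightarrow> real) \<Rightarrow> 'a smeasure \<Rightarrow> real" where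
  "sintegral a \<mu> = (\<integral>x. a x \<partial>(fst \<mu>)) - (\<integral>x. a x \<partial>(snd \<mu>))"

definition supported_in :: "'a::euclidean_space set \<Rightarrow> 'a smeasure \<Rightarrow> bool" where
  "supported_in \<Omega>' \<mu> \<longleftrightarrow>
     (\<exists>N \<in> sets borel. - \<Omega>' \<subseteq> N \<and> emeasure (fst \<mu>) N = 0 \<and> emeasure (snd \<mu>) N = 0)"

definition Meas :: "'a::euclidean_space set \<Rightarrow> 'a set \<Rightarrow> 'a smeasure set" where
  "Meas \<Omega> \<Omega>' = {\<mu>. is_smeasure \<Omega> \<mu> \<and> supported_in \<Omega>' \<mu>}"

(* C_0(\<Omega>): continuous on \<Omega>, vanishing at infinity (i.e. at the boundary of \<Omega>
   and at \<infinity>); extended by 0 outside \<Omega>. *)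
definition C0 :: "'a::euclidean_space set \<Rightarrow> ('a \<Rightarrow> real) set" where
  "C0 \<Omega> = {a. continuous_on \<Omega> a \<and>
               (\<forall>e>0. \<exists>K. compact K \<and> K \<subseteq> \<Omega> \<and> (\<forall>x\<in>\<Omega> - K. \<bar>a x\<bar> < e)) \<and>
               (\<forall>x. x \<notin> \<Omega> \<longrightarrow> a x = 0)}"

definition weakstar_conv :: "'a::euclidean_space set \<Rightarrow> (nat \<Rightarrow> 'a smeasure) \<Rightarrow> 'a smeasure \<Rightarrow> bool" where
  "weakstar_conv \<Omega> \<mu>s \<mu> \<longleftrightarrow>
     (\<forall>\<phi> \<in> C0 \<Omega>. (\<lambda>n. sintegral \<phi> (\<mu>s n)) \<longlonglongrightarrow> sintegral \<phi> \<mu>)"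

definition opA :: "('m::finite \<Rightarrow> 'a::euclidean_space \<Rightarrow> real) \<Rightarrow> 'a smeasure \<Rightarrow> real^'m" where
  "opA a \<mu> = (\<chi> i. sintegral (a i) \<mu>)"

definition opAadj :: "('m::finite \<Rightarrow> 'a::euclidean_space \<Rightarrow> real) \<Rightarrow> real^'m \<Rightarrow> 'a \<Rightarrow> real" where
  "opAadj a q = (\<lambda>x. \<Sum>i\<in>UNIV. q $ i * a i x)"

definition proper_fun :: "('b \<Rightarrow> ereal) \<Rightarrow> bool" where
  "proper_fun f \<longleftrightarrow> (\<forall>y. f y \<noteq> -\<infinity>) \<and> (\<exists>y. f y \<noteq> \<infinity>)"

definition convex_ext :: "('b::real_vector \<Rightarrow> ereal) \<Rightarrow> bool" where
  "convex_ext f \<longleftrightarrow> (\<forall>x y. \<forall>t::real. 0 < t \<and> t < 1 \<longrightarrow>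
       f ((1 - t) *\<^sub>R x + t *\<^sub>R y) \<le> ereal (1 - t) * f x + ereal t * f y)"

definition lsc_ext :: "('b::topological_space \<Rightarrow> ereal) \<Rightarrow> bool" where
  "lsc_ext f \<longleftrightarrow> (\<forall>y c. c < f y \<longrightarrow> (\<forall>\<^sub>F z in nhds y. c < f z))"

definition conj_fun :: "(real^'m::finite \<Rightarrow> ereal) \<Rightarrow> real^'m \<Rightarrow> ereal" where
  "conj_fun f q = (SUP y. ereal (q \<bullet> y) - f y)"

definition Jfun :: "('m::finite \<Rightarrow> 'a::euclidean_space \<Rightarrow> real) \<Rightarrow> (real^'m \<Rightarrow> ereal)
                    \<Rightarrow> 'a smeasure \<Rightarrow> ereal" where
  "Jfun a f \<mu> = ereal (tv_norm \<mu>) + f (opA a \<mu>)"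

definition val_P :: "'a::euclidean_space set \<Rightarrow> ('m::finite \<Rightarrow> 'a \<Rightarrow> real) \<Rightarrow> (real^'m \<Rightarrow> ereal)
                     \<Rightarrow> 'a set \<Rightarrow> ereal" where
  "val_P \<Omega> a f \<Omega>' = (INF \<mu> \<in> Meas \<Omega> \<Omega>'. Jfun a f \<mu>)"

definition solves_P :: "'a::euclidean_space set \<Rightarrow> ('m::finite \<Rightarrow> 'a \<Rightarrow> real) \<Rightarrow> (real^'m \<Rightarrow> ereal)
                     \<Rightarrow> 'a set \<Rightarrow> 'a smeasure \<Rightarrow> bool" where
  "solves_P \<Omega> a f \<Omega>' \<mu> \<longleftrightarrow> \<mu> \<in> Meas \<Omega> \<Omega>' \<and> (\<forall>\<nu> \<in> Meas \<Omega> \<Omega>'. Jfun a f \<mu> \<le> Jfun a f \<nu>)"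

definition feas_D :: "('m::finite \<Rightarrow> 'a::euclidean_space \<Rightarrow> real) \<Rightarrow> 'a set \<Rightarrow> (real^'m) set" where
  "feas_D a \<Omega>' = {q. \<forall>x \<in> \<Omega>'. \<bar>opAadj a q x\<bar> \<le> 1}"

definition val_D :: "('m::finite \<Rightarrow> 'a::euclidean_space \<Rightarrow> real) \<Rightarrow> (real^'m \<Rightarrow> ereal)
                     \<Rightarrow> 'a set \<Rightarrow> ereal" where
  "val_D a f \<Omega>' = (SUP q \<in> feas_D a \<Omega>'. - conj_fun f q)"

definition solves_D :: "('m::finite \<Rightarrow> 'a::euclidean_space \<Rightarrow> real) \<Rightarrow> (real^'m \<Rightarrow> ereal)
                     \<Rightarrow> 'a set \<Rightarrow> real^'m \<Rightarrow> bool" where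
  "solves_D a f \<Omega>' q \<longleftrightarrow> q \<in> feas_D a \<Omega>' \<and>
      (\<forall>p \<in> feas_D a \<Omega>'. - conj_fun f p \<le> - conj_fun f q)"

definition standing :: "'a::euclidean_space set \<Rightarrow> ('m::finite \<Rightarrow> 'a \<Rightarrow> real) \<Rightarrow> (real^'m \<Rightarrow> ereal)
                     \<Rightarrow> 'a set \<Rightarrow> bool" where
  "standing \<Omega> a f \<Omega>' \<longleftrightarrow> (\<exists>\<mu>. solves_P \<Omega> a f \<Omega>' \<mu>) \<and> (\<exists>q. solves_D a f \<Omega>' q) \<and>
                          val_P \<Omega> a f \<Omega>' = val_D a f \<Omega>'"

definition local_max_in :: "'a::metric_space set \<Rightarrow> ('a \<Rightarrow> real) \<Rightarrow> 'a \<Rightarrow> bool" where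
  "local_max_in \<Omega> g x \<longleftrightarrow> x \<in> \<Omega> \<and> (\<exists>e>0. \<forall>y \<in> \<Omega> \<inter> ball x e. g y \<le> g x)"

definition exch_X :: "'a::euclidean_space set \<Rightarrow> ('m::finite \<Rightarrow> 'a \<Rightarrow> real) \<Rightarrow> real^'m \<Rightarrow> 'a set" where
  "exch_X \<Omega> a q = {x. local_max_in \<Omega> (\<lambda>y. \<bar>opAadj a q y\<bar>) x \<and> \<bar>opAadj a q x\<bar> > 1}"

end

theory Submission
  imports Defs
begin

text \<open>
  Bounded sequences of finite Borel measures on \<open>\<real>\<^sup>d\<close> have weak-* convergent subsequences:
  a Borel injection into \<open>[0,1]\<close> through which all \<open>C0\<close> functions factor continuously reduces this to
  Helly's selection theorem on the line. Applied to both Jordan parts, and followed by a new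
  Jordan decomposition of the limit, it gives weak-* compactness of bounded sets of signed measures
  together with lower semicontinuity of the norm.

  The optimal values \<open>J(\<mu>\<^sub>k) = -f\<^sup>*(q\<^sub>k)\<close> decrease to some \<open>V \<ge> inf(P)\<close>. The \<open>q\<^sub>k\<close> are bounded: under H1,
  \<open>f\<close> is bounded on the unit ball and hence \<open>f\<^sup>*(q) \<ge> \<bar>q\<bar> - C\<close>; under H2 one tests with measures on
  \<open>\<Omega>\<^sub>0\<close> that are mapped to the unit vectors. If \<open>\<bar>A\<^sup>*q\<^sub>k\<bar>\<close> exceeds 1, its maximizer enters \<open>\<Omega>\<^sub>k\<^sub>+\<^sub>1\<close>, so
  \<open>sup \<bar>A\<^sup>*q\<^sub>k\<bar> \<le> 1 + C \<bar>q\<^sub>k - q\<^sub>l\<bar>\<close> for all \<open>l > k\<close>, and every limit \<open>q\<close> is feasible for (D). By lower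
  semicontinuity \<open>V \<le> -f\<^sup>*(q) \<le> sup(D) = inf(P) \<le> V\<close>, and \<open>J(\<mu>) \<le> V\<close> for every weak-* limit \<open>\<mu>\<close>.
\<close>

section \<open>Coding points by real numbers\<close>

text \<open>At a first nonzero digit the term has size 2/3^(n+1), while all later terms together
  contribute at most 1/3^(n+1), so they cannot cancel it to below 1/3^(n+1). Strong induction
  supplies the vanishing of the earlier digits.\<close>

lemma ternary_digits_zero:
  fixes d :: "nat \<Rightarrow> real"
  assumes d: "\<And>n. d n \<in> {-1, 0, 1}"
    and small: "\<bar>\<Sum>n. d n * (2 / 3 ^ Suc n)\<bar> < 1 / 3 ^ N" and "n < N"
  shows "d n = 0"
  using \<open>n < N\<close>
proof (induction n rule: less_induct)
  case (less n)
  let ?t = "\<lambda>n. d n * (2 / 3 ^ Suc n)"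
  have geo: "(\<lambda>k. 2 / 3 ^ Suc (k + Suc n) :: real) sums (1 / 3 ^ Suc n)"
    using sums_mult[OF geometric_sums[of "1/3::real"], of "2 / 3 ^ Suc (Suc n)"]
    by (simp add: power_add field_simps)
  have le: "norm (?t (k + Suc n)) \<le> 2 / 3 ^ Suc (k + Suc n)" for k
  proof -
    have "\<bar>d (k + Suc n)\<bar> \<le> 1" using d[of "k + Suc n"] by auto
    then show ?thesis by (simp add: abs_mult divide_right_mono)
  qed
  have sm: "summable (\<lambda>k. ?t (k + Suc n))"
    by (rule summable_comparison_test'[OF sums_summable[OF geo], of 0]) (use le in auto)
  have tail: "\<bar>\<Sum>k. ?t (k + Suc n)\<bar> \<le> 1 / 3 ^ Suc n"
    using norm_suminf_le[OF le sums_summable[OF geo]] sums_unique[OF geo] by simp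
  have "(\<Sum>i<Suc n. ?t i) = ?t n"
    using less by (simp add: sum.neutral)
  then have split: "(\<Sum>n. ?t n) = (\<Sum>k. ?t (k + Suc n)) + ?t n"
    using suminf_split_initial_segment[OF summable_iff_shift[of ?t "Suc n", THEN iffD1, OF sm], of "Suc n"]
    by simp
  have "1 / 3 ^ N \<le> (1 / 3 ^ Suc n :: real)"
    using less.prems by (intro divide_left_mono power_increasing) auto
  with small have lt: "\<bar>\<Sum>n. ?t n\<bar> < 1 / 3 ^ Suc n" by linarith
  have "2 / 3 ^ Suc n = 2 * (1 / 3 ^ Suc n :: real)" by simp
  moreover have "0 < (1 / 3 ^ Suc n :: real)" by simp
  ultimately show ?case
    using d[of n] tail lt unfolding split by (auto simp del: power_Suc)
qed

section \<open>Functions in \<open>C0\<close>: extension by zero, boundedness and limits\<close>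

text \<open>Only points outside \<Omega> need an argument: the complement of a compact K inside
  \<Omega> is an open neighbourhood of such a point, and the function is small there. Compactness
  can thus be proved on the whole space first.\<close>

lemma C0_UNIV_I:
  assumes "open \<Omega>" "\<phi> \<in> C0 \<Omega>"
  shows "\<phi> \<in> C0 UNIV"
proof -
  have small: "\<exists>K. compact K \<and> K \<subseteq> \<Omega> \<and> (\<forall>x. x \<notin> K \<longrightarrow> \<bar>\<phi> x\<bar> < e)" if "e > 0" for e
  proof -
    obtain K where "compact K" "K \<subseteq> \<Omega>" "\<forall>x\<in>\<Omega> - K. \<bar>\<phi> x\<bar> < e"
      using assms \<open>e > 0\<close> unfolding C0_def by blast
    moreover have "\<bar>\<phi> x\<bar> < e" if "x \<notin> \<Omega>" for x
      using that assms \<open>e > 0\<close> by (auto simp: C0_def)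
    ultimately show ?thesis by blast
  qed
  have "isCont \<phi> x" for x
  proof (cases "x \<in> \<Omega>")
    case True
    then show ?thesis
      using assms by (auto simp: C0_def continuous_on_eq_continuous_at)
  next
    case False
    then have "\<phi> x = 0" using assms by (auto simp: C0_def)
    have "(\<phi> \<longlongrightarrow> 0) (at x)"
    proof (rule tendstoI)
      fix e :: real assume "e > 0"
      then obtain K where K: "compact K" "K \<subseteq> \<Omega>" "\<forall>x. x \<notin> K \<longrightarrow> \<bar>\<phi> x\<bar> < e"
        using small by blast
      have "open (- K)" "x \<in> - K" using K False compact_imp_closed by auto
      then have "\<forall>\<^sub>F y in at x. y \<in> - K" by (auto simp: eventually_at_topological)
      then show "\<forall>\<^sub>F y in at x. dist (\<phi> y) 0 < e"
        by eventually_elim (use K in auto)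
    qed
    then show ?thesis by (simp add: isCont_def \<open>\<phi> x = 0\<close>)
  qed
  then have "continuous_on UNIV \<phi>" by (simp add: continuous_at_imp_continuous_on)
  with small show ?thesis unfolding C0_def by fastforce
qed

lemma C0_UNIV_bounded:
  assumes "\<phi> \<in> C0 UNIV"
  obtains B where "\<And>x. \<bar>\<phi> x\<bar> \<le> B"
proof -
  obtain K where K: "compact K" "\<forall>x\<in>UNIV - K. \<bar>\<phi> x\<bar> < 1"
    using assms zero_less_one unfolding C0_def by blast
  have "continuous_on K \<phi>" using assms by (auto simp: C0_def intro: continuous_on_subset)
  then have "bounded (\<phi> ` K)" using K compact_continuous_image compact_imp_bounded by blast
  then obtain B where "\<forall>x\<in>K. \<bar>\<phi> x\<bar> \<le> B" by (auto simp: bounded_iff)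
  then have "\<bar>\<phi> x\<bar> \<le> max B 1" for x
    using K by (cases "x \<in> K") (auto simp: le_max_iff_disj less_imp_le)
  then show thesis by (rule that)
qed

lemma C0_UNIV_measurable [measurable_dest]:
  "\<phi> \<in> C0 UNIV \<Longrightarrow> \<phi> \<in> borel_measurable borel"
  by (simp add: C0_def borel_measurable_continuous_onI)

lemma C0_UNIV_tendsto:
  "\<phi> \<in> C0 UNIV \<Longrightarrow> (X \<longlongrightarrow> x) F \<Longrightarrow> ((\<lambda>n. \<phi> (X n)) \<longlongrightarrow> \<phi> x) F"
  by (rule continuous_on_tendsto_compose[of UNIV]) (auto simp: C0_def)

lemma C0_UNIV_tendsto_at_infinity:
  assumes "\<phi> \<in> C0 UNIV" shows "(\<phi> \<longlongrightarrow> 0) at_infinity"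
proof (rule tendstoI)
  fix e :: real assume "e > 0"
  then obtain K where "compact K" "\<forall>x\<in>UNIV - K. \<bar>\<phi> x\<bar> < e"
    using assms unfolding C0_def by blast
  moreover obtain B where "\<forall>x\<in>K. norm x \<le> B"
    using \<open>compact K\<close> compact_imp_bounded bounded_iff by blast
  ultimately have "\<forall>x. norm x \<ge> B + 1 \<longrightarrow> dist (\<phi> x) 0 < e"
    by (metis Diff_iff UNIV_I add_le_same_cancel1 dist_0_norm dist_commute not_one_le_zero order_trans real_norm_def)
  then show "\<forall>\<^sub>F x in at_infinity. dist (\<phi> x) 0 < e"
    by (auto simp: eventually_at_infinity)
qed

lemma C0_UNIV_I_at_infinity:
  fixes \<phi> :: "'a::euclidean_space \<Rightarrow> real"
  assumes "continuous_on UNIV \<phi>" "(\<phi> \<longlongrightarrow> 0) at_infinity"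
  shows "\<phi> \<in> C0 UNIV"
proof -
  have "\<exists>K. compact K \<and> (\<forall>x. x \<notin> K \<longrightarrow> \<bar>\<phi> x\<bar> < e)" if "e > 0" for e
  proof -
    obtain B where "\<forall>x. norm x \<ge> B \<longrightarrow> dist (\<phi> x) 0 < e"
      using tendstoD[OF assms(2) \<open>e > 0\<close>] by (auto simp: eventually_at_infinity)
    then show ?thesis
      by (intro exI[of _ "cball 0 B"]) auto
  qed
  with assms show ?thesis unfolding C0_def by (simp add: Ball_def)
qed

text \<open>Uniform continuity extends \<open>h\<close> to the closure, Tietze extends it from there
  to the line, and truncation at -B and B restores the bound.\<close>

lemma continuous_on_UNIV_extension:
  fixes h :: "real \<Rightarrow> real"
  assumes "uniformly_continuous_on S h" "\<And>x. x \<in> S \<Longrightarrow> \<bar>h x\<bar> \<le> B" "0 \<le> B"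
  obtains H where "continuous_on UNIV H" "\<And>x. x \<in> S \<Longrightarrow> H x = h x" "\<And>x. \<bar>H x\<bar> \<le> B"
proof -
  obtain g where g: "uniformly_continuous_on (closure S) g" "\<And>x. x \<in> S \<Longrightarrow> h x = g x"
    using uniformly_continuous_on_extension_on_closure[OF assms(1)] by metis
  obtain H where H: "continuous_on UNIV H" "\<And>x. x \<in> closure S \<Longrightarrow> H x = g x"
    using Tietze_unbounded[of "closure S" g UNIV] g(1)
    by (auto simp: uniformly_continuous_imp_continuous)
  show thesis
  proof
    show "continuous_on UNIV (\<lambda>x. max (- B) (min B (H x)))"
      by (intro continuous_intros H)
    show "max (- B) (min B (H x)) = h x" if "x \<in> S" for x
      using that assms(2)[OF that] H(2)[of x] g(2)[OF that] closure_subset[of S] by auto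
  qed (use \<open>0 \<le> B\<close> in auto)
qed

text \<open>The code of \<open>x\<close> is the ternary number whose digits record membership of \<open>x\<close> in the sets of a
  countable base. Codes that are close agree on many base sets, so \<open>C0\<close> functions are uniformly
  continuous as functions of the code although the code itself is only Borel.\<close>

theorem C0_factors_through_real_code:
  obtains s :: "'a::euclidean_space \<Rightarrow> real"
  where "s \<in> borel_measurable borel" "\<And>x. 0 \<le> s x" "\<And>x. s x \<le> 1"
    "\<forall>\<phi> \<in> C0 UNIV. \<exists>\<Phi> B. continuous_on UNIV \<Phi> \<and> (\<forall>t. \<bar>\<Phi> t\<bar> \<le> B) \<and> (\<forall>x. \<Phi> (s x) = \<phi> x)"
proof -
  obtain B :: "nat \<Rightarrow> 'a set" where B: "\<And>n. open (B n)"
    and basis: "\<And>S. open S \<Longrightarrow> \<exists>k. S = \<Union>{B n |n. n \<in> k}"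
  proof (rule univ_second_countable_sequence)
    fix B :: "nat \<Rightarrow> 'a set"
    assume "\<And>n. open (B n)" "\<And>S. open S \<Longrightarrow> \<exists>k. S = \<Union>{B n |n. n \<in> k}"
    then show thesis by (rule that)
  qed
  define s where "s = (\<lambda>x. \<Sum>n. indicator (B n) x * (2 / 3 ^ Suc n :: real))"
  have geo: "(\<lambda>n. 2 / 3 ^ Suc n :: real) sums 1"
    using sums_mult[OF geometric_sums[of "1/3::real"], of "2 / 3"] by (simp add: power_divide)
  have smm: "summable (\<lambda>n. indicator (B n) x * (2 / 3 ^ Suc n :: real))" for x
    by (rule summable_comparison_test'[OF sums_summable[OF geo], of 0]) (auto simp: indicator_def)
  have [measurable]: "B n \<in> sets borel" for n using B by auto
  have smeas: "s \<in> borel_measurable borel" unfolding s_def by measurable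
  have s0: "0 \<le> s x" for x unfolding s_def by (rule suminf_nonneg[OF smm]) auto
  have s1: "s x \<le> 1" for x
    unfolding s_def sums_unique[OF geo]
    by (rule suminf_le[OF _ smm sums_summable[OF geo]]) (auto simp: indicator_def)
  \<comment> \<open>The difference of two codes is a ternary series with digits -1, 0, 1, so
    sufficiently close codes have the same initial digits.\<close>
  have agree: "x \<in> B n \<longleftrightarrow> y \<in> B n" if "\<bar>s x - s y\<bar> < 1 / 3 ^ N" "n < N" for x y n N
  proof -
    have "s x - s y = (\<Sum>n. (indicator (B n) x - indicator (B n) y) * (2 / 3 ^ Suc n))"
      unfolding s_def suminf_diff[OF smm smm] by (simp only: left_diff_distrib)
    then have "indicator (B n) x - indicator (B n) y = (0::real)"
      using that by (intro ternary_digits_zero[of "\<lambda>n. indicator (B n) x - indicator (B n) y" N n])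
        (auto simp: indicator_def)
    then show ?thesis by (auto simp: indicator_def split: if_splits)
  qed
  have uc: "\<exists>\<delta>>0. \<forall>x y. \<bar>s x - s y\<bar> < \<delta> \<longrightarrow> \<bar>\<phi> x - \<phi> y\<bar> < e"
    if \<phi>: "\<phi> \<in> C0 UNIV" and "e > 0" for \<phi> e
  proof -
    have c: "continuous_on UNIV \<phi>" using \<phi> by (simp add: C0_def)
    have "e/2 > 0" using \<open>e > 0\<close> by simp
    then obtain K where K: "compact K" "\<forall>x\<in>UNIV - K. \<bar>\<phi> x\<bar> < e/2"
      using \<phi> unfolding C0_def by blast
    have "\<exists>n. x \<in> B n \<and> (\<forall>y\<in>B n. \<bar>\<phi> y - \<phi> x\<bar> < e/2)" for x
    proof -
      have "open {y. \<bar>\<phi> y - \<phi> x\<bar> < e/2}"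
        by (intro open_Collect_less continuous_intros c)
      then obtain k where k: "{y. \<bar>\<phi> y - \<phi> x\<bar> < e/2} = \<Union>{B n |n. n \<in> k}" using basis by blast
      moreover have "x \<in> {y. \<bar>\<phi> y - \<phi> x\<bar> < e/2}" using \<open>e > 0\<close> by simp
      ultimately show ?thesis by blast
    qed
    then obtain n where n: "\<And>x. x \<in> B (n x)" "\<And>x y. y \<in> B (n x) \<Longrightarrow> \<bar>\<phi> y - \<phi> x\<bar> < e/2" by metis
    have "K \<subseteq> (\<Union>x\<in>K. B (n x))" using n(1) by auto
    then obtain F where F: "finite F" "K \<subseteq> (\<Union>x\<in>F. B (n x))"
      using compactE_image[OF K(1), of K "\<lambda>x. B (n x)"] B by metis
    \<comment> \<open>\<open>N\<close> exceeds the indices of the finitely many base sets covering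
      K. Codes closer than 1/3^N therefore put both points into a common base set, on which \<phi>
      stays within e/2 of its value at the centre.\<close>
    define N where "N = Suc (Max (insert 0 (n ` F)))"
    have N: "n x < N" if "x \<in> F" for x unfolding N_def using that F(1) by (simp add: less_Suc_eq_le)
    have main: "\<bar>\<phi> x - \<phi> y\<bar> < e" if xy: "x \<in> K" "\<bar>s x - s y\<bar> < 1 / 3 ^ N" for x y
    proof -
      obtain z where "z \<in> F" "x \<in> B (n z)" using F xy by blast
      moreover from this have "y \<in> B (n z)" using agree[OF xy(2) N] by blast
      ultimately show ?thesis using n(2)[of x z] n(2)[of y z] by linarith
    qed
    have "\<bar>\<phi> x - \<phi> y\<bar> < e" if st: "\<bar>s x - s y\<bar> < 1 / 3 ^ N" for x y
    proof (cases "x \<in> K \<or> y \<in> K")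
      case True
      then show ?thesis using main[of x y] main[of y x] st by (auto simp: abs_minus_commute)
    next
      case False
      then show ?thesis using bspec[OF K(2), of x] bspec[OF K(2), of y] by auto
    qed
    then show ?thesis by (intro exI[of _ "1 / 3 ^ N"]) auto
  qed
  show thesis
  proof (rule that[OF smeas s0 s1], rule ballI)
    fix \<phi> :: "'a \<Rightarrow> real" assume \<phi>: "\<phi> \<in> C0 UNIV"
    \<comment> \<open>Taking e to be the gap between the two values, equal codes would make this gap
      smaller than itself. Hence the choice in \<open>h\<close> below is immaterial on the range of
      \<open>s\<close>.\<close>
    have eq: "\<phi> x = \<phi> y" if "s x = s y" for x y
    proof (rule ccontr)
      assume "\<phi> x \<noteq> \<phi> y"
      then have "0 < \<bar>\<phi> x - \<phi> y\<bar>" by simp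
      then obtain \<delta> where "\<delta> > 0" "\<bar>s x - s y\<bar> < \<delta> \<longrightarrow> \<bar>\<phi> x - \<phi> y\<bar> < \<bar>\<phi> x - \<phi> y\<bar>"
        using uc[OF \<phi>] by blast
      then show False using that by simp
    qed
    define h where "h t = \<phi> (SOME x. s x = t)" for t
    have h: "h (s x) = \<phi> x" for x
      unfolding h_def by (rule eq) (rule someI[of "\<lambda>y. s y = s x"], simp)
    have ucs: "uniformly_continuous_on (range s) h"
      unfolding uniformly_continuous_on_def
      using uc[OF \<phi>] by (force simp: h dist_real_def)
    obtain B where B: "\<And>x. \<bar>\<phi> x\<bar> \<le> B" using C0_UNIV_bounded[OF \<phi>] by blast
    have "0 \<le> B" using B[of 0] by linarith
    with continuous_on_UNIV_extension[OF ucs, of B] B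
    show "\<exists>\<Phi> B. continuous_on UNIV \<Phi> \<and> (\<forall>t. \<bar>\<Phi> t\<bar> \<le> B) \<and> (\<forall>x. \<Phi> (s x) = \<phi> x)"
      by (metis h rangeE rangeI)
  qed
qed

section \<open>Weak-* compactness\<close>

text \<open>The pushforwards under the code live on [0,1], hence are tight and have a limit law
  \<open>N\<close> by Helly's theorem. Each point in the closure of the codes is a limit of codes of
  points that either converge or escape to infinity; keeping only the first kind and decoding it
  gives \<open>M\<close>. The escaping mass is why the total is only bounded by 1.\<close>

theorem prob_weakstar_subsequence:
  fixes \<rho> :: "nat \<Rightarrow> 'a::euclidean_space measure"
  assumes prob: "\<And>n. prob_space (\<rho> n)" and sets_\<rho> [measurable_cong]: "\<And>n. sets (\<rho> n) = sets borel"
  obtains r M where "strict_mono (r :: nat \<Rightarrow> nat)" "sets M = sets borel" "emeasure M UNIV \<le> 1"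
    "\<forall>\<phi>\<in>C0 UNIV. (\<lambda>n. \<integral>x. \<phi> x \<partial>\<rho> (r n)) \<longlonglongrightarrow> (\<integral>x. \<phi> x \<partial>M)"
proof -
  obtain s :: "'a \<Rightarrow> real" where s [measurable]: "s \<in> borel_measurable borel"
    and s01: "\<And>x. 0 \<le> s x" "\<And>x. s x \<le> 1"
    and ext: "\<forall>\<phi> \<in> C0 UNIV. \<exists>\<Phi> B. continuous_on UNIV \<Phi> \<and> (\<forall>t. \<bar>\<Phi> t\<bar> \<le> B) \<and> (\<forall>x. \<Phi> (s x) = \<phi> x)"
    by (rule C0_factors_through_real_code) (rule that; simp)
  obtain E where E: "\<And>\<phi>. \<phi> \<in> C0 UNIV \<Longrightarrow> continuous_on UNIV (E \<phi>)"
    "\<And>\<phi>. \<phi> \<in> C0 UNIV \<Longrightarrow> \<exists>B. \<forall>t. \<bar>E \<phi> t\<bar> \<le> B" "\<And>\<phi> x. \<phi> \<in> C0 UNIV \<Longrightarrow> E \<phi> (s x) = \<phi> x"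
    using ext by metis
  define \<sigma> where "\<sigma> n = distr (\<rho> n) borel s" for n
  have rd: "real_distribution (\<sigma> n)" for n
  proof -
    interpret prob_space "\<rho> n" by (rule prob)
    show ?thesis unfolding \<sigma>_def by (rule real_distribution_distr) simp
  qed
  \<comment> \<open>Tightness is phrased with half-open intervals; the left end -1 keeps the code 0
    inside.\<close>
  have mass: "measure (\<sigma> n) {-1<..1} = 1" for n
  proof -
    interpret prob_space "\<rho> n" by (rule prob)
    have "s -` {-1<..1} \<inter> space (\<rho> n) = space (\<rho> n)"
      using s01 by (auto intro!: less_le_trans[of "-1" 0 "s _"])
    then show ?thesis by (simp add: \<sigma>_def measure_distr prob_space)
  qed
  have "tight \<sigma>"
    unfolding tight_def
  proof (intro conjI allI impI)
    fix \<epsilon> :: real assume "0 < \<epsilon>"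
    then show "\<exists>a b. a < b \<and> (\<forall>n. 1 - \<epsilon> < measure (\<sigma> n) {a<..b})"
      by (intro exI[of _ "-1"] exI[of _ 1]) (simp add: mass)
  qed (rule rd)
  then obtain r N where r: "strict_mono r" and N: "real_distribution N" "weak_conv_m (\<sigma> \<circ> id \<circ> r) N"
    using tight_imp_convergent_subsubsequence[of \<sigma> id] by (auto simp: strict_mono_def)
  interpret N: real_distribution N by (rule N)
  have conv: "(\<lambda>n. \<integral>x. h (s x) \<partial>\<rho> (r n)) \<longlonglongrightarrow> (\<integral>t. h t \<partial>N)"
    if "continuous_on UNIV h" "\<And>t. \<bar>h t\<bar> \<le> B" for h :: "real \<Rightarrow> real" and B
  proof -
    have [measurable]: "h \<in> borel_measurable borel" using that(1) by (rule borel_measurable_continuous_onI)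
    have "(\<lambda>n. integral\<^sup>L ((\<sigma> \<circ> id \<circ> r) n) h) \<longlonglongrightarrow> integral\<^sup>L N h"
      using that rd N
      by (intro weak_conv_imp_integral_bdd_continuous_conv[of _ _ _ B])
        (auto simp: continuous_on_eq_continuous_at comp_def)
    moreover have "integral\<^sup>L ((\<sigma> \<circ> id \<circ> r) n) h = (\<integral>x. h (s x) \<partial>\<rho> (r n))" for n
      unfolding \<sigma>_def by (simp add: integral_distr)
    ultimately show ?thesis by simp
  qed
  define K where "K = closure (range s)"
  have K: "closed K" "K \<noteq> {}" "\<And>x. s x \<in> K" using closure_subset[of "range s"] by (auto simp: K_def)
  \<comment> \<open>A bounded continuous test function whose zero set is exactly \<open>K\<close>.
    Its integrals against the pushforwards vanish, hence so does its integral against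
    \<open>N\<close>, which shows that \<open>N\<close> is carried by \<open>K\<close>.\<close>
  define h where "h t = min 1 (infdist t K)" for t
  have hc: "continuous_on UNIV h" unfolding h_def by (intro continuous_intros)
  have [measurable]: "h \<in> borel_measurable borel" using hc by (rule borel_measurable_continuous_onI)
  have h0: "0 \<le> h t" and h1: "\<bar>h t\<bar> \<le> 1" for t by (auto simp: h_def infdist_nonneg)
  have hs: "h (s x) = 0" for x using K(3) by (simp add: h_def)
  have "(\<lambda>n. \<integral>x. h (s x) \<partial>\<rho> (r n)) \<longlonglongrightarrow> (\<integral>t. h t \<partial>N)" by (rule conv[OF hc h1])
  then have "(\<integral>t. h t \<partial>N) = 0" by (simp add: hs LIMSEQ_const_iff)
  moreover have "integrable N h"
    by (rule N.integrable_const_bound[of _ 1]) (use h1 in auto)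
  ultimately have "AE t in N. h t = 0"
    using integral_nonneg_eq_0_iff_AE[of N h] h0 by auto
  then have AE_K: "AE t in N. t \<in> K"
  proof eventually_elim
    case (elim t)
    then have "infdist t K = 0" by (auto simp: h_def min_def split: if_splits)
    then show ?case using in_closed_iff_infdist_zero K by blast
  qed

  \<comment> \<open>Where \<open>E e0\<close> does not vanish, the quotients \<open>E (e b) / E e0\<close> recover the coordinates of the point
    encoded by \<open>t\<close>; the zeros of \<open>E e0\<close> on \<open>K\<close> are the codes of the point at infinity, where mass is lost.\<close>
  define e0 :: "'a \<Rightarrow> real" where "e0 = (\<lambda>x. 1 / (1 + (norm x)\<^sup>2))"
  define e where "e = (\<lambda>b x::'a. (x \<bullet> b) / (1 + (norm x)\<^sup>2))"
  have pos: "0 < 1 + (norm x)\<^sup>2" for x :: 'a by (simp add: add_pos_nonneg)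
  have inv0: "((\<lambda>x::'a. inverse (norm x)) \<longlongrightarrow> 0) at_infinity"
    by (intro tendsto_inverse_0_at_top filterlim_norm_at_top)
  have e0: "e0 \<in> C0 UNIV"
  proof (rule C0_UNIV_I_at_infinity)
    show "continuous_on UNIV e0" unfolding e0_def
      by (intro continuous_intros) (use pos in \<open>auto simp: less_imp_neq[symmetric]\<close>)
    have "norm (e0 x) \<le> inverse (norm x)" if "1 \<le> norm x" for x
    proof -
      have "norm x \<le> 1 + (norm x)\<^sup>2" using self_le_power[OF that, of 2] by simp
      then have "inverse (1 + (norm x)\<^sup>2) \<le> inverse (norm x)"
        using that by (intro le_imp_inverse_le) auto
      then show ?thesis using pos[of x] by (simp add: e0_def inverse_eq_divide)
    qed
    then show "(e0 \<longlongrightarrow> 0) at_infinity"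
      by (intro Lim_null_comparison[OF _ inv0]) (auto simp: eventually_at_infinity)
  qed
  have e: "e b \<in> C0 UNIV" if "b \<in> Basis" for b
  proof (rule C0_UNIV_I_at_infinity)
    show "continuous_on UNIV (e b)" unfolding e_def
      by (intro continuous_intros) (use pos in \<open>auto simp: less_imp_neq[symmetric]\<close>)
    have "norm (e b x) \<le> inverse (norm x)" if "1 \<le> norm x" for x
    proof -
      have "\<bar>x \<bullet> b\<bar> * norm x \<le> norm x * norm x"
        using Basis_le_norm[OF \<open>b \<in> Basis\<close>, of x] by (intro mult_right_mono) auto
      also have "\<dots> \<le> 1 + (norm x)\<^sup>2" by (simp add: power2_eq_square)
      finally have "\<bar>x \<bullet> b\<bar> \<le> (1 + (norm x)\<^sup>2) / norm x" using that by (subst pos_le_divide_eq) auto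
      then have "\<bar>x \<bullet> b\<bar> / (1 + (norm x)\<^sup>2) \<le> inverse (norm x)"
        using pos[of x] by (subst pos_divide_le_eq) (auto simp: divide_inverse mult.commute)
      then show ?thesis using pos[of x] by (simp add: e_def)
    qed
    then show "(e b \<longlongrightarrow> 0) at_infinity"
      by (intro Lim_null_comparison[OF _ inv0]) (auto simp: eventually_at_infinity)
  qed
  have e_div: "e b x / e0 x = x \<bullet> b" for b x
    using pos[of x] by (simp add: e_def e0_def)
  define p where "p t = (\<Sum>b\<in>Basis. (E (e b) t / E e0 t) *\<^sub>R b)" for t
  define D where "D = {t. E e0 t \<noteq> 0}"
  have [measurable]: "E \<phi> \<in> borel_measurable borel" if "\<phi> \<in> C0 UNIV" for \<phi>
    using E(1)[OF that] by (rule borel_measurable_continuous_onI)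
  note this[OF e0, measurable] this[OF e, measurable]
  have [measurable]: "p \<in> borel_measurable borel" unfolding p_def by measurable
  have [measurable]: "D \<in> sets borel" unfolding D_def by measurable
  \<comment> \<open>Choose points whose codes tend to \<open>t\<close>. If \<open>E e0 t\<close> is
    nonzero, their coordinates, being quotients of convergent sequences, converge to those of
    \<open>p t\<close>. Otherwise \<open>e0\<close> tends to 0 along them, so they leave every ball
    and \<phi> tends to 0.\<close>
  have key: "E \<phi> t = indicator D t * \<phi> (p t)" if "t \<in> K" and \<phi>: "\<phi> \<in> C0 UNIV" for t \<phi>
  proof -
    obtain x where x: "(\<lambda>n. s (x n)) \<longlonglongrightarrow> t"
    proof -
      obtain y where y: "\<forall>n. y n \<in> range s" "y \<longlonglongrightarrow> t"
        using \<open>t \<in> K\<close> unfolding K_def closure_sequential by auto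
      have "\<forall>n. \<exists>x. y n = s x" using y(1) by auto
      then obtain x where "\<forall>n. y n = s (x n)" by metis
      then have "y = (\<lambda>n. s (x n))" by auto
      then show thesis using that[of x] y(2) by simp
    qed
    have lim: "(\<lambda>n. \<psi> (x n)) \<longlonglongrightarrow> E \<psi> t" if "\<psi> \<in> C0 UNIV" for \<psi>
      using continuous_on_tendsto_compose[OF E(1)[OF that] x] by (simp add: E(3)[OF that])
    show ?thesis
    proof (cases "t \<in> D")
      case True
      have "(\<lambda>n. \<Sum>b\<in>Basis. (e b (x n) / e0 (x n)) *\<^sub>R b) \<longlonglongrightarrow> p t"
        unfolding p_def using True
        by (intro tendsto_intros lim e e0) (auto simp: D_def)
      then have "x \<longlonglongrightarrow> p t" by (simp add: e_div euclidean_representation)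
      then have "(\<lambda>n. \<phi> (x n)) \<longlonglongrightarrow> \<phi> (p t)" by (rule C0_UNIV_tendsto[OF \<phi>])
      then show ?thesis using lim[OF \<phi>] LIMSEQ_unique True by fastforce
    next
      case False
      then have l0: "(\<lambda>n. e0 (x n)) \<longlonglongrightarrow> 0" using lim[OF e0] by (simp add: D_def)
      have "filterlim x at_infinity sequentially"
        unfolding filterlim_at_infinity[OF order_refl, of x]
      proof (intro allI impI)
        fix R :: real assume "0 < R"
        then have "0 < 1 / (1 + R\<^sup>2)" by (simp add: add_pos_nonneg)
        then have "\<forall>\<^sub>F n in sequentially. e0 (x n) < 1 / (1 + R\<^sup>2)" by (rule order_tendstoD(2)[OF l0])
        then show "\<forall>\<^sub>F n in sequentially. R \<le> norm (x n)"
        proof eventually_elim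
          case (elim n)
          then have "1 + R\<^sup>2 < 1 + (norm (x n))\<^sup>2"
            using pos[of "x n"] add_pos_nonneg[of 1 "R\<^sup>2"] by (simp add: e0_def field_simps)
          then have "R < norm (x n)" by (intro power_less_imp_less_base[of R 2]) auto
          then show ?case by simp
        qed
      qed
      from filterlim_compose[OF C0_UNIV_tendsto_at_infinity[OF \<phi>] this]
      have "E \<phi> t = 0" using lim[OF \<phi>] LIMSEQ_unique by blast
      with False show ?thesis by simp
    qed
  qed
  \<comment> \<open>The density removes the mass sitting on codes of the point at infinity before
    \<open>p\<close> decodes the rest.\<close>
  define M where "M = distr (density N (\<lambda>t. ennreal (indicator D t))) borel p"
  have em: "emeasure M UNIV \<le> 1"
  proof -
    have "emeasure M UNIV = (\<integral>\<^sup>+t. ennreal (indicator D t) \<partial>N)"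
      unfolding M_def by (subst emeasure_distr) (auto simp: emeasure_density)
    also have "\<dots> \<le> (\<integral>\<^sup>+t. 1 \<partial>N)" by (intro nn_integral_mono) (auto simp: indicator_def)
    also have "\<dots> = 1" using N.emeasure_space_1 by simp
    finally show ?thesis .
  qed
  have "(\<lambda>n. \<integral>x. \<phi> x \<partial>\<rho> (r n)) \<longlonglongrightarrow> (\<integral>x. \<phi> x \<partial>M)" if \<phi>: "\<phi> \<in> C0 UNIV" for \<phi>
  proof -
    note [measurable] = C0_UNIV_measurable[OF \<phi>]
    obtain B where "\<And>t. \<bar>E \<phi> t\<bar> \<le> B" using E(2)[OF \<phi>] by blast
    from conv[OF E(1)[OF \<phi>] this] have "(\<lambda>n. \<integral>x. \<phi> x \<partial>\<rho> (r n)) \<longlonglongrightarrow> (\<integral>t. E \<phi> t \<partial>N)"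
      by (simp add: E(3)[OF \<phi>])
    also have "(\<integral>t. E \<phi> t \<partial>N) = (\<integral>t. indicator D t * \<phi> (p t) \<partial>N)"
    proof (rule integral_cong_AE)
      show "E \<phi> \<in> borel_measurable N" using E(1)[OF \<phi>] by (simp add: borel_measurable_continuous_onI)
      show "AE t in N. E \<phi> t = indicator D t * \<phi> (p t)"
        using AE_K by eventually_elim (rule key[OF _ \<phi>])
    qed simp
    also have "\<dots> = (\<integral>x. \<phi> x \<partial>M)"
      unfolding M_def by (subst integral_distr) (auto simp: integral_density)
    finally show ?thesis .
  qed
  then show thesis by (intro that[OF r _ em]) (auto simp: M_def)
qed

section \<open>Jordan decomposition of a difference of two finite measures\<close>

text \<open>Serves as a common dominating measure, with respect to which both summands have
  densities.\<close>

definition measure_sum :: "'a measure \<Rightarrow> 'a measure \<Rightarrow> 'a measure" where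
  "measure_sum P N = measure_of (space P) (sets P) (\<lambda>A. emeasure P A + emeasure N A)"

lemma sets_measure_sum [simp, measurable_cong]: "sets (measure_sum P N) = sets P"
  by (simp add: measure_sum_def)

lemma emeasure_measure_sum:
  assumes "sets N = sets P" "A \<in> sets P"
  shows "emeasure (measure_sum P N) A = emeasure P A + emeasure N A"
  unfolding measure_sum_def
proof (rule emeasure_measure_of_sigma)
  show "sigma_algebra (space P) (sets P)" by (rule sets.sigma_algebra_axioms)
  show "positive (sets P) (\<lambda>A. emeasure P A + emeasure N A)" by (simp add: positive_def)
  show "countably_additive (sets P) (\<lambda>A. emeasure P A + emeasure N A)"
    using assms(1) by (auto simp: countably_additive_def suminf_add[symmetric] suminf_emeasure)
qed (rule assms)

lemma integrable_C0_UNIV: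
  fixes M :: "'a::euclidean_space measure"
  assumes "finite_measure M" "sets M = sets borel" "\<phi> \<in> C0 UNIV"
  shows "integrable M \<phi>"
proof -
  obtain B where "\<And>x. \<bar>\<phi> x\<bar> \<le> B" using C0_UNIV_bounded[OF assms(3)] by blast
  moreover have "\<phi> \<in> borel_measurable M"
    using C0_UNIV_measurable[OF assms(3)] assms(2) by (simp cong: measurable_cong_sets)
  ultimately show ?thesis
    using assms(1) by (intro finite_measure.integrable_const_bound[of M _ B]) auto
qed

text \<open>Weak-* limits of mutually singular parts may overlap, so they must be separated again.
  With densities p and n relative to P + N, the positive parts of p - n and n - p live on disjoint
  sets, are dominated by p and n, and have difference p - n.\<close>

lemma Jordan_decomposition:
  fixes P N :: "'a::euclidean_space measure"
  assumes sets_P [measurable_cong]: "sets P = sets borel" and sets_N [measurable_cong]: "sets N = sets borel"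
    and fin: "finite_measure P" "finite_measure N"
    and null: "emeasure P (- \<Omega>) = 0" "emeasure N (- \<Omega>) = 0" and "open \<Omega>"
  obtains \<mu> where "is_smeasure \<Omega> \<mu>" "tv_norm \<mu> \<le> measure P UNIV + measure N UNIV"
    "\<And>\<phi>. \<phi> \<in> C0 UNIV \<Longrightarrow> sintegral \<phi> \<mu> = (\<integral>x. \<phi> x \<partial>P) - (\<integral>x. \<phi> x \<partial>N)"
proof -
  interpret P: finite_measure P by (rule fin)
  interpret N: finite_measure N by (rule fin)
  have spaces: "space P = UNIV" "space N = UNIV"
    using sets_eq_imp_space_eq[OF sets_P] sets_eq_imp_space_eq[OF sets_N] by auto
  define S where "S = measure_sum P N"
  have sets_S [measurable_cong]: "sets S = sets borel" by (simp add: S_def sets_P)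
  have space_S: "space S = UNIV" using sets_eq_imp_space_eq[OF sets_S] by simp
  have S: "emeasure S A = emeasure P A + emeasure N A" if "A \<in> sets borel" for A
    using that by (simp add: S_def emeasure_measure_sum sets_P sets_N)
  interpret S: finite_measure S
    by (rule finite_measureI) (simp add: S space_S P.emeasure_finite N.emeasure_finite)
  have RN: "\<exists>d. d \<in> borel_measurable borel \<and> (\<forall>x. 0 \<le> d x) \<and> M = density S (\<lambda>x. ennreal (d x))"
    if "M = P \<or> M = N" for M
  proof -
    have M: "finite_measure M" "sets M = sets S" using that fin sets_P sets_N sets_S by auto
    have ac: "absolutely_continuous S M"
      unfolding absolutely_continuous_def using that sets_S sets_P sets_N
      by (auto simp: null_sets_def S)
    obtain d where d: "d \<in> borel_measurable S" "AE x in S. RN_deriv S M x = ennreal (d x)" "\<And>x. 0 \<le> d x"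
      using S.real_RN_deriv[OF M(1) ac M(2)] by metis
    have "M = density S (RN_deriv S M)" by (rule S.density_RN_deriv[OF ac M(2), symmetric])
    also have "\<dots> = density S (\<lambda>x. ennreal (d x))"
      by (rule density_cong) (use d in auto)
    finally show ?thesis using d sets_S by (auto cong: measurable_cong_sets)
  qed
  obtain p where p [measurable]: "p \<in> borel_measurable borel" and p0: "\<And>x. 0 \<le> p x"
    and P: "P = density S (\<lambda>x. ennreal (p x))" using RN[of P] by blast
  obtain n where n [measurable]: "n \<in> borel_measurable borel" and n0: "\<And>x. 0 \<le> n x"
    and N: "N = density S (\<lambda>x. ennreal (n x))" using RN[of N] by blast
  define U where "U = density S (\<lambda>x. ennreal (max 0 (p x - n x)))"
  define V where "V = density S (\<lambda>x. ennreal (max 0 (n x - p x)))"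
  have sets_UV [measurable_cong, simp]: "sets U = sets borel" "sets V = sets borel"
    by (auto simp: U_def V_def sets_S)
  have UP: "emeasure U A \<le> emeasure P A" and VN: "emeasure V A \<le> emeasure N A"
    if [measurable]: "A \<in> sets borel" for A
    using p0 n0 unfolding U_def V_def
    by (subst P N; auto simp: emeasure_density intro!: nn_integral_mono mult_right_mono ennreal_leI)+
  have fU: "finite_measure U" and fV: "finite_measure V"
    using UP[of UNIV] VN[of UNIV] P.emeasure_finite[of UNIV] N.emeasure_finite[of UNIV]
    by (auto intro!: finite_measureI simp: U_def V_def space_S top_unique)
  have open_sets: "- \<Omega> \<in> sets borel" using \<open>open \<Omega>\<close> by auto
  have "is_smeasure \<Omega> (U, V)"
    unfolding is_smeasure_def fst_conv snd_conv
  proof (intro conjI fU fV sets_UV)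
    show "emeasure U (- \<Omega>) = 0" "emeasure V (- \<Omega>) = 0"
      using UP[OF open_sets] VN[OF open_sets] null by simp_all
    have [measurable]: "{x. n x < p x} \<in> sets borel" by measurable
    show "\<exists>A\<in>sets borel. emeasure U (- A) = 0 \<and> emeasure V A = 0"
    proof (intro bexI[of _ "{x. n x < p x}"] conjI)
      show "emeasure U (- {x. n x < p x}) = 0" unfolding U_def
        by (subst emeasure_density) (auto simp: nn_integral_0_iff_AE ennreal_eq_0_iff indicator_def intro!: AE_I2)
      show "emeasure V {x. n x < p x} = 0" unfolding V_def
        by (subst emeasure_density) (auto simp: nn_integral_0_iff_AE ennreal_eq_0_iff indicator_def intro!: AE_I2)
    qed measurable
  qed
  moreover have "tv_norm (U, V) \<le> measure P UNIV + measure N UNIV"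
    unfolding tv_norm_def fst_conv snd_conv
    using UP[of UNIV] VN[of UNIV] P.emeasure_finite[of UNIV] N.emeasure_finite[of UNIV]
    unfolding measure_def by (intro add_mono enn2real_mono) (auto simp: less_top[symmetric])
  moreover have "sintegral \<phi> (U, V) = (\<integral>x. \<phi> x \<partial>P) - (\<integral>x. \<phi> x \<partial>N)" if \<phi>: "\<phi> \<in> C0 UNIV" for \<phi>
  proof -
    note [measurable] = C0_UNIV_measurable[OF \<phi>]
    have dens: "integrable S (\<lambda>x. d x * \<phi> x)" "(\<integral>x. \<phi> x \<partial>M) = (\<integral>x. d x * \<phi> x \<partial>S)"
      if "M = density S (\<lambda>x. ennreal (d x))" "d \<in> borel_measurable borel" "\<And>x. 0 \<le> d x"
        "finite_measure M" for M d
    proof -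
      note [measurable] = that(2)
      have "integrable M \<phi>" by (rule integrable_C0_UNIV[OF that(4) _ \<phi>]) (simp add: that(1) sets_S)
      then show "integrable S (\<lambda>x. d x * \<phi> x)" unfolding that(1)
        using that(3) by (subst (asm) integrable_density) auto
      show "(\<integral>x. \<phi> x \<partial>M) = (\<integral>x. d x * \<phi> x \<partial>S)" unfolding that(1)
        using that(3) by (subst integral_density) auto
    qed
    note dP = dens[OF P p p0 fin(1)] and dN = dens[OF N n n0 fin(2)]
    have dU: "integrable S (\<lambda>x. max 0 (p x - n x) * \<phi> x)"
      "(\<integral>x. \<phi> x \<partial>U) = (\<integral>x. max 0 (p x - n x) * \<phi> x \<partial>S)"
      by (rule dens[OF U_def _ _ fU]; simp)+
    have dV: "integrable S (\<lambda>x. max 0 (n x - p x) * \<phi> x)"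
      "(\<integral>x. \<phi> x \<partial>V) = (\<integral>x. max 0 (n x - p x) * \<phi> x \<partial>S)"
      by (rule dens[OF V_def _ _ fV]; simp)+
    have "sintegral \<phi> (U, V) = (\<integral>x. max 0 (p x - n x) * \<phi> x - max 0 (n x - p x) * \<phi> x \<partial>S)"
      unfolding sintegral_def fst_conv snd_conv dU(2) dV(2) by (simp add: dU(1) dV(1))
    also have "\<dots> = (\<integral>x. p x * \<phi> x - n x * \<phi> x \<partial>S)"
      by (intro Bochner_Integration.integral_cong) (auto simp: max_def algebra_simps)
    also have "\<dots> = (\<integral>x. \<phi> x \<partial>P) - (\<integral>x. \<phi> x \<partial>N)"
      unfolding dP(2) dN(2) by (simp add: dP(1) dN(1))
    finally show ?thesis .
  qed
  ultimately show thesis by (rule that)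
qed

section \<open>From probability measures to signed measures on \<Omega>\<close>

text \<open>Normalize to probability measures, pass to a further subsequence along which the masses
  converge to m, and rescale the limit by m. As mass can be lost, m is returned separately; the
  bound by m is the semicontinuity of the norm.\<close>

theorem finite_measure_weakstar_subsequence:
  fixes \<mu> :: "nat \<Rightarrow> 'a::euclidean_space measure"
  assumes fin: "\<And>n. finite_measure (\<mu> n)" and sets_\<mu> [measurable_cong]: "\<And>n. sets (\<mu> n) = sets borel"
    and bdd: "\<And>n. measure (\<mu> n) UNIV \<le> C"
  obtains r M m where "strict_mono (r :: nat \<Rightarrow> nat)" "sets M = sets borel" "finite_measure M"
    "measure M UNIV \<le> m" "(\<lambda>n. measure (\<mu> (r n)) UNIV) \<longlonglongrightarrow> m"
    "\<And>\<phi>. \<phi> \<in> C0 UNIV \<Longrightarrow> (\<lambda>n. \<integral>x. \<phi> x \<partial>\<mu> (r n)) \<longlonglongrightarrow> (\<integral>x. \<phi> x \<partial>M)"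
proof -
  define c where "c n = measure (\<mu> n) UNIV" for n
  have c0: "0 \<le> c n" for n by (simp add: c_def)
  have space_\<mu>: "space (\<mu> n) = UNIV" for n using sets_eq_imp_space_eq[OF sets_\<mu>] by simp
  have cE: "emeasure (\<mu> n) UNIV = ennreal (c n)" for n
    unfolding c_def by (simp add: finite_measure.emeasure_eq_measure[OF fin])
  \<comment> \<open>A zero measure is replaced by an arbitrary probability measure; the factor
    \<open>c n\<close> = 0 keeps the rescaling identity valid.\<close>
  define \<rho> where "\<rho> n = (if c n = 0 then return borel 0 else density (\<mu> n) (\<lambda>_. ennreal (1 / c n)))" for n
  have sets_\<rho>: "sets (\<rho> n) = sets borel" for n by (simp add: \<rho>_def sets_\<mu>)
  have prob: "prob_space (\<rho> n)" for n
  proof (cases "c n = 0")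
    case False
    then have "0 < c n" using c0[of n] by simp
    then have "emeasure (\<rho> n) (space (\<rho> n)) = 1"
      using space_\<mu>[of n] sets.top[of "\<mu> n"]
      by (simp add: \<rho>_def emeasure_density cE ennreal_mult'[symmetric])
    then show ?thesis by (rule prob_spaceI)
  qed (simp add: \<rho>_def prob_space_return)
  have scale: "(\<integral>x. \<phi> x \<partial>\<mu> n) = c n * (\<integral>x. \<phi> x \<partial>\<rho> n)" if \<phi>: "\<phi> \<in> C0 UNIV" for n \<phi>
  proof (cases "c n = 0")
    case True
    have "AE x in \<mu> n. \<phi> x = 0"
      by (rule AE_I'[of "UNIV"]) (use True cE[of n] sets_\<mu>[of n] in auto)
    then show ?thesis using True by (simp add: integral_eq_zero_AE)
  next
    case False
    then show ?thesis
      using c0[of n] C0_UNIV_measurable[OF \<phi>] by (simp add: \<rho>_def integral_density cong: measurable_cong_sets)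
  qed
  obtain r1 M where r1: "strict_mono (r1 :: nat \<Rightarrow> nat)" and M: "sets M = sets borel" "emeasure M UNIV \<le> 1"
    and conv: "\<forall>\<phi>\<in>C0 UNIV. (\<lambda>n. \<integral>x. \<phi> x \<partial>\<rho> (r1 n)) \<longlonglongrightarrow> (\<integral>x. \<phi> x \<partial>M)"
    by (rule prob_weakstar_subsequence[OF prob sets_\<rho>]) (rule that)
  have "bounded (range (c \<circ> r1))"
    using bdd c0 by (auto simp: bounded_iff c_def intro!: exI[of _ C])
  then obtain m r2 where r2: "strict_mono (r2 :: nat \<Rightarrow> nat)" and m: "((c \<circ> r1) \<circ> r2) \<longlonglongrightarrow> m"
    using bounded_imp_convergent_subsequence by blast
  have m0: "0 \<le> m" by (rule LIMSEQ_le_const[OF m]) (simp add: c0)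
  define M' where "M' = density M (\<lambda>_. ennreal m)"
  have space_M: "space M = UNIV" using sets_eq_imp_space_eq[OF M(1)] by simp
  have "emeasure M' UNIV = ennreal m * emeasure M UNIV"
    using space_M sets.top[of M] by (simp add: M'_def emeasure_density)
  also have "\<dots> \<le> ennreal m * 1" by (intro mult_left_mono M) simp
  finally have M'_le: "emeasure M' UNIV \<le> ennreal m" by simp
  show thesis
  proof (rule that[of "r1 \<circ> r2" M' m])
    show "strict_mono (r1 \<circ> r2)" using r1 r2 by (rule strict_mono_o)
    show "sets M' = sets borel" by (simp add: M'_def M)
    show "finite_measure M'"
      using M'_le by (intro finite_measureI) (auto simp: M'_def space_M top_unique)
    show "measure M' UNIV \<le> m"
      using M'_le m0 by (metis enn2real_mono enn2real_ennreal ennreal_less_top measure_def)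
    show "(\<lambda>n. measure (\<mu> ((r1 \<circ> r2) n)) UNIV) \<longlonglongrightarrow> m"
      using m by (simp add: c_def comp_def)
    fix \<phi> :: "'a \<Rightarrow> real" assume \<phi>: "\<phi> \<in> C0 UNIV"
    have "(\<lambda>n. c (r1 (r2 n)) * (\<integral>x. \<phi> x \<partial>\<rho> (r1 (r2 n)))) \<longlonglongrightarrow> m * (\<integral>x. \<phi> x \<partial>M)"
      using m LIMSEQ_subseq_LIMSEQ[OF bspec[OF conv \<phi>] r2] by (intro tendsto_mult) (auto simp: comp_def)
    moreover have "m * (\<integral>x. \<phi> x \<partial>M) = (\<integral>x. \<phi> x \<partial>M')"
      using m0 C0_UNIV_measurable[OF \<phi>] M(1)
      by (simp add: M'_def integral_density cong: measurable_cong_sets)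
    ultimately show "(\<lambda>n. \<integral>x. \<phi> x \<partial>\<mu> ((r1 \<circ> r2) n)) \<longlonglongrightarrow> (\<integral>x. \<phi> x \<partial>M')"
      by (simp add: scale[OF \<phi>])
  qed
qed

text \<open>A limit taken in the whole space can charge the complement of \<Omega>. Functions in
  \<open>C0 \<Omega>\<close> vanish there, so this mass can be discarded without changing any of
  their integrals.\<close>

lemma restrict_to_open:
  fixes M :: "'a::euclidean_space measure"
  assumes sets_M [measurable_cong]: "sets M = sets borel" and "finite_measure M" "open \<Omega>"
  obtains P where "sets P = sets borel" "finite_measure P" "emeasure P (- \<Omega>) = 0"
    "measure P UNIV \<le> measure M UNIV" "\<And>\<phi>. \<phi> \<in> C0 \<Omega> \<Longrightarrow> (\<integral>x. \<phi> x \<partial>P) = (\<integral>x. \<phi> x \<partial>M)"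
proof -
  interpret finite_measure M by fact
  have space_M: "space M = UNIV" using sets_eq_imp_space_eq[OF sets_M] by simp
  have [measurable]: "\<Omega> \<in> sets borel" using \<open>open \<Omega>\<close> by simp
  define P where "P = density M (\<lambda>x. ennreal (indicator \<Omega> x))"
  have PE: "emeasure P A = emeasure M (\<Omega> \<inter> A)" if "A \<in> sets borel" for A
    using that \<open>open \<Omega>\<close> by (simp add: P_def emeasure_density ennreal_indicator sets_M
        indicator_inter_arith[symmetric])
  show thesis
  proof (rule that[of P])
    show "sets P = sets borel" by (simp add: P_def sets_M)
    show "finite_measure P"
      by (rule finite_measureI) (simp add: P_def[THEN arg_cong, of space] PE space_M)
    show "emeasure P (- \<Omega>) = 0" by (simp add: PE)
    show "measure P UNIV \<le> measure M UNIV"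
      using finite_measure_mono[of \<Omega> UNIV] sets_M by (simp add: measure_def PE)
    fix \<phi> :: "'a \<Rightarrow> real" assume \<phi>: "\<phi> \<in> C0 \<Omega>"
    have [measurable]: "\<phi> \<in> borel_measurable borel"
      using C0_UNIV_measurable[OF C0_UNIV_I[OF \<open>open \<Omega>\<close> \<phi>]] .
    have "(\<integral>x. \<phi> x \<partial>P) = (\<integral>x. indicator \<Omega> x * \<phi> x \<partial>M)"
      unfolding P_def by (subst integral_density) auto
    also have "\<dots> = (\<integral>x. \<phi> x \<partial>M)"
      using \<phi> by (intro Bochner_Integration.integral_cong) (auto simp: C0_def indicator_def)
    finally show "(\<integral>x. \<phi> x \<partial>P) = (\<integral>x. \<phi> x \<partial>M)" .
  qed
qed

text \<open>The subsequence is extracted first for the positive and then for the negative parts. The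
  limit m of the norms is returned because the values of f along the algorithm are recovered as J
  minus the norm.\<close>

theorem smeasure_weakstar_subsequence:
  fixes \<mu> :: "nat \<Rightarrow> 'a::euclidean_space smeasure"
  assumes "open \<Omega>" and sm: "\<And>n. is_smeasure \<Omega> (\<mu> n)" and bdd: "\<And>n. tv_norm (\<mu> n) \<le> C"
  obtains r \<nu> m where "strict_mono (r :: nat \<Rightarrow> nat)" "is_smeasure \<Omega> \<nu>" "weakstar_conv \<Omega> (\<mu> \<circ> r) \<nu>"
    "(\<lambda>n. tv_norm (\<mu> (r n))) \<longlonglongrightarrow> m" "tv_norm \<nu> \<le> m"
proof -
  have f: "finite_measure (fst (\<mu> n))" "sets (fst (\<mu> n)) = sets borel"
    "finite_measure (snd (\<mu> n))" "sets (snd (\<mu> n)) = sets borel" for n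
    using sm[of n] by (auto simp: is_smeasure_def)
  have b: "measure (fst (\<mu> n)) UNIV \<le> C" "measure (snd (\<mu> n)) UNIV \<le> C" for n
    using bdd[of n] measure_nonneg[of "fst (\<mu> n)" UNIV] measure_nonneg[of "snd (\<mu> n)" UNIV]
    unfolding tv_norm_def by linarith+
  obtain r1 M1 m1 where r1: "strict_mono (r1 :: nat \<Rightarrow> nat)" and M1: "sets M1 = sets borel" "finite_measure M1"
    "measure M1 UNIV \<le> m1" "(\<lambda>n. measure (fst (\<mu> (r1 n))) UNIV) \<longlonglongrightarrow> m1"
    "\<And>\<phi>. \<phi> \<in> C0 UNIV \<Longrightarrow> (\<lambda>n. \<integral>x. \<phi> x \<partial>fst (\<mu> (r1 n))) \<longlonglongrightarrow> (\<integral>x. \<phi> x \<partial>M1)"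
    using finite_measure_weakstar_subsequence[of "\<lambda>n. fst (\<mu> n)" C] f b by metis
  obtain r2 M2 m2 where r2: "strict_mono (r2 :: nat \<Rightarrow> nat)" and M2: "sets M2 = sets borel" "finite_measure M2"
    "measure M2 UNIV \<le> m2" "(\<lambda>n. measure (snd (\<mu> (r1 (r2 n)))) UNIV) \<longlonglongrightarrow> m2"
    "\<And>\<phi>. \<phi> \<in> C0 UNIV \<Longrightarrow> (\<lambda>n. \<integral>x. \<phi> x \<partial>snd (\<mu> (r1 (r2 n)))) \<longlonglongrightarrow> (\<integral>x. \<phi> x \<partial>M2)"
    using finite_measure_weakstar_subsequence[of "\<lambda>n. snd (\<mu> (r1 n))" C] f b by metis
  obtain P where P: "sets P = sets borel" "finite_measure P" "emeasure P (- \<Omega>) = 0"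
    "measure P UNIV \<le> measure M1 UNIV" "\<And>\<phi>. \<phi> \<in> C0 \<Omega> \<Longrightarrow> (\<integral>x. \<phi> x \<partial>P) = (\<integral>x. \<phi> x \<partial>M1)"
    using restrict_to_open[OF M1(1,2) \<open>open \<Omega>\<close>] by metis
  obtain N where N: "sets N = sets borel" "finite_measure N" "emeasure N (- \<Omega>) = 0"
    "measure N UNIV \<le> measure M2 UNIV" "\<And>\<phi>. \<phi> \<in> C0 \<Omega> \<Longrightarrow> (\<integral>x. \<phi> x \<partial>N) = (\<integral>x. \<phi> x \<partial>M2)"
    using restrict_to_open[OF M2(1,2) \<open>open \<Omega>\<close>] by metis
  obtain \<nu> where \<nu>: "is_smeasure \<Omega> \<nu>" "tv_norm \<nu> \<le> measure P UNIV + measure N UNIV"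
    "\<And>\<phi>. \<phi> \<in> C0 UNIV \<Longrightarrow> sintegral \<phi> \<nu> = (\<integral>x. \<phi> x \<partial>P) - (\<integral>x. \<phi> x \<partial>N)"
    using Jordan_decomposition[OF P(1) N(1) P(2) N(2) P(3) N(3) \<open>open \<Omega>\<close>] by metis
  show thesis
  proof (rule that[of "r1 \<circ> r2" \<nu> "m1 + m2"])
    show "strict_mono (r1 \<circ> r2)" using r1 r2 by (rule strict_mono_o)
    show "(\<lambda>n. tv_norm (\<mu> ((r1 \<circ> r2) n))) \<longlonglongrightarrow> m1 + m2"
      unfolding tv_norm_def using LIMSEQ_subseq_LIMSEQ[OF M1(4) r2] M2(4)
      by (intro tendsto_add) (auto simp: comp_def)
    show "tv_norm \<nu> \<le> m1 + m2" using \<nu>(2) P(4) N(4) M1(3) M2(3) by linarith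
    show "weakstar_conv \<Omega> (\<mu> \<circ> (r1 \<circ> r2)) \<nu>"
      unfolding weakstar_conv_def
    proof
      fix \<phi> assume \<phi>: "\<phi> \<in> C0 \<Omega>"
      note \<phi>' = C0_UNIV_I[OF \<open>open \<Omega>\<close> \<phi>]
      have eq: "sintegral \<phi> \<nu> = (\<integral>x. \<phi> x \<partial>M1) - (\<integral>x. \<phi> x \<partial>M2)"
        by (simp add: \<nu>(3)[OF \<phi>'] P(5)[OF \<phi>] N(5)[OF \<phi>])
      show "(\<lambda>n. sintegral \<phi> ((\<mu> \<circ> (r1 \<circ> r2)) n)) \<longlonglongrightarrow> sintegral \<phi> \<nu>"
        unfolding eq unfolding sintegral_def
        using LIMSEQ_subseq_LIMSEQ[OF M1(5)[OF \<phi>'] r2] M2(5)[OF \<phi>']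
        by (intro tendsto_diff) (auto simp: comp_def)
    qed
  qed (rule \<nu>)
qed

section \<open>The exchange algorithm\<close>

text \<open>If convergence failed, enumerating the infinitely many terms that stay at distance at
  least e from the limit would give a subsequence violating the hypothesis. This turns uniqueness of
  solutions into convergence of the whole sequence.\<close>

lemma LIMSEQ_if_subseq_LIMSEQ:
  fixes X :: "nat \<Rightarrow> 'b::metric_space"
  assumes sub: "\<And>s. strict_mono (s :: nat \<Rightarrow> nat) \<Longrightarrow> \<exists>r. strict_mono (r :: nat \<Rightarrow> nat) \<and> (\<lambda>n. X (s (r n))) \<longlonglongrightarrow> l"
  shows "X \<longlonglongrightarrow> l"
proof (rule ccontr)
  assume "\<not> X \<longlonglongrightarrow> l"
  then obtain e where "e > 0" and "\<not> (\<forall>\<^sub>F n in sequentially. dist (X n) l < e)"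
    by (auto simp: tendsto_iff)
  then have inf: "infinite {n. \<not> dist (X n) l < e}"
    by (simp add: eventually_cofinite cofinite_eq_sequentially[symmetric])
  let ?s = "enumerate {n. \<not> dist (X n) l < e}"
  obtain r where "strict_mono (r :: nat \<Rightarrow> nat)" "(\<lambda>n. X (?s (r n))) \<longlonglongrightarrow> l"
    using sub[OF strict_mono_enumerate[OF inf]] by blast
  then have "\<forall>\<^sub>F n in sequentially. dist (X (?s (r n))) l < e" using \<open>e > 0\<close> by (auto simp: tendsto_iff)
  then obtain n where "dist (X (?s (r n))) l < e" by (auto simp: eventually_sequentially)
  then show False using enumerate_in_set[OF inf, of "r n"] by simp
qed

section \<open>The pairing of measures with \<open>C0\<close> functions, and the adjoint
  operator\<close>

lemma smeasure_integrable:
  assumes "is_smeasure \<Omega> \<nu>" "\<phi> \<in> C0 UNIV"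
  shows "integrable (fst \<nu>) \<phi>" "integrable (snd \<nu>) \<phi>"
  using assms by (auto simp: is_smeasure_def intro!: integrable_C0_UNIV)

lemma inner_opA:
  assumes "is_smeasure \<Omega> \<nu>" "\<And>i. a i \<in> C0 UNIV"
  shows "p \<bullet> opA a \<nu> = sintegral (opAadj a p) \<nu>"
proof -
  note int = smeasure_integrable[OF assms(1) assms(2)]
  have "sintegral (opAadj a p) \<nu> = (\<Sum>i\<in>UNIV. p $ i * (\<integral>x. a i x \<partial>fst \<nu>)) - (\<Sum>i\<in>UNIV. p $ i * (\<integral>x. a i x \<partial>snd \<nu>))"
    unfolding sintegral_def opAadj_def by (simp add: int)
  then show ?thesis
    by (simp add: inner_vec_def opA_def sintegral_def sum_subtractf right_diff_distrib)
qed

lemma abs_integral_le_measure: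
  fixes M :: "'a::euclidean_space measure"
  assumes "finite_measure M" "sets M = sets borel" "\<phi> \<in> C0 UNIV" "AE x in M. \<bar>\<phi> x\<bar> \<le> 1"
  shows "\<bar>\<integral>x. \<phi> x \<partial>M\<bar> \<le> measure M UNIV"
proof -
  interpret finite_measure M by fact
  have space: "space M = UNIV" using sets_eq_imp_space_eq[OF assms(2)] by simp
  have "\<bar>\<integral>x. \<phi> x \<partial>M\<bar> \<le> (\<integral>x. \<bar>\<phi> x\<bar> \<partial>M)" using integral_norm_bound[of M \<phi>] by simp
  also have "\<dots> \<le> (\<integral>x. 1 \<partial>M)"
    using integrable_C0_UNIV[OF assms(1-3)] assms(4) by (intro integral_mono_AE) auto
  finally show ?thesis by (simp add: space)
qed

text \<open>The set \<Omega>' is arbitrary, so the Borel null set from \<open>supported_in\<close>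
  stands in for its complement: off that set the bound on \<phi> holds, hence almost everywhere for
  both Jordan parts.\<close>

lemma abs_sintegral_le_tv_norm:
  assumes "\<nu> \<in> Meas \<Omega> \<Omega>'" "\<phi> \<in> C0 UNIV" and le: "\<And>x. x \<in> \<Omega>' \<Longrightarrow> \<bar>\<phi> x\<bar> \<le> 1"
  shows "\<bar>sintegral \<phi> \<nu>\<bar> \<le> tv_norm \<nu>"
proof -
  have sm: "is_smeasure \<Omega> \<nu>" and "supported_in \<Omega>' \<nu>" using assms by (auto simp: Meas_def)
  then obtain N where N: "N \<in> sets borel" "- \<Omega>' \<subseteq> N" "emeasure (fst \<nu>) N = 0" "emeasure (snd \<nu>) N = 0"
    by (auto simp: supported_in_def)
  have fin: "finite_measure (fst \<nu>)" "finite_measure (snd \<nu>)"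
    and sets: "sets (fst \<nu>) = sets borel" "sets (snd \<nu>) = sets borel"
    using sm by (auto simp: is_smeasure_def)
  have sub: "{x. \<not> \<bar>\<phi> x\<bar> \<le> 1} \<subseteq> N" using N(2) le by blast
  have "AE x in fst \<nu>. \<bar>\<phi> x\<bar> \<le> 1"
    by (rule AE_I'[of N]) (use N sets sub in \<open>auto simp: null_sets_def\<close>)
  moreover have "AE x in snd \<nu>. \<bar>\<phi> x\<bar> \<le> 1"
    by (rule AE_I'[of N]) (use N sets sub in \<open>auto simp: null_sets_def\<close>)
  ultimately show ?thesis
    using abs_integral_le_measure[OF fin(1) sets(1) assms(2)] abs_integral_le_measure[OF fin(2) sets(2) assms(2)]
    unfolding sintegral_def tv_norm_def by linarith
qed

lemma opAadj_C0_UNIV: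
  assumes "\<And>i. a i \<in> C0 UNIV"
  shows "opAadj a p \<in> C0 UNIV"
proof (rule C0_UNIV_I_at_infinity)
  show "continuous_on UNIV (opAadj a p)"
    unfolding opAadj_def using assms by (intro continuous_intros) (auto simp: C0_def)
  have "((\<lambda>x. \<Sum>i\<in>UNIV. p $ i * a i x) \<longlongrightarrow> (\<Sum>i\<in>UNIV. p $ i * 0)) at_infinity"
    by (intro tendsto_intros C0_UNIV_tendsto_at_infinity assms)
  then show "(opAadj a p \<longlongrightarrow> 0) at_infinity" by (simp add: opAadj_def)
qed

lemma opAadj_bound:
  assumes "\<And>i. a i \<in> C0 UNIV"
  shows "\<exists>C. \<forall>p x. \<bar>opAadj a p x\<bar> \<le> C * norm p"
proof -
  have "\<forall>i. \<exists>B. \<forall>x. \<bar>a i x\<bar> \<le> B" using C0_UNIV_bounded[OF assms] by metis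
  then obtain B where B: "\<And>i x. \<bar>a i x\<bar> \<le> B i" by metis
  have "\<bar>opAadj a p x\<bar> \<le> (\<Sum>i\<in>UNIV. B i) * norm p" for p x
  proof -
    have "\<bar>opAadj a p x\<bar> \<le> (\<Sum>i\<in>UNIV. \<bar>p $ i * a i x\<bar>)" unfolding opAadj_def by (rule sum_abs)
    also have "\<dots> \<le> (\<Sum>i\<in>UNIV. norm p * B i)"
      unfolding abs_mult by (intro sum_mono mult_mono component_le_norm_cart B) auto
    finally have "\<bar>opAadj a p x\<bar> \<le> norm p * (\<Sum>i\<in>UNIV. B i)" by (simp add: sum_distrib_left)
    then show ?thesis by (simp add: mult.commute)
  qed
  then show ?thesis by blast
qed

lemma opAadj_diff: "opAadj a (p - p') x = opAadj a p x - opAadj a p' x"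
  by (simp add: opAadj_def left_diff_distrib sum_subtractf)

text \<open>Outside a compact set the modulus is below 1, so a value above 1 forces the supremum to
  be attained. The maximizer lies in \<Omega>, where alone the function can be nonzero, and a global
  maximizer is a local one.\<close>

lemma exch_X_maximizer:
  assumes a: "\<And>i. a i \<in> C0 UNIV" and zero: "\<And>i x. x \<notin> \<Omega> \<Longrightarrow> a i x = 0"
    and big: "\<bar>opAadj a p x\<bar> > 1"
  shows "\<exists>y\<in>exch_X \<Omega> a p. \<forall>z. \<bar>opAadj a p z\<bar> \<le> \<bar>opAadj a p y\<bar>"
proof -
  let ?g = "opAadj a p"
  have g: "?g \<in> C0 UNIV" by (rule opAadj_C0_UNIV[OF a])
  then obtain K where K: "compact K" "\<forall>x\<in>UNIV - K. \<bar>?g x\<bar> < 1"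
    using zero_less_one unfolding C0_def by blast
  have "x \<in> K" using K(2) big by force
  have "continuous_on K (\<lambda>x. \<bar>?g x\<bar>)"
    using g by (intro continuous_intros) (auto simp: C0_def intro: continuous_on_subset)
  then obtain y where y: "y \<in> K" "\<forall>z\<in>K. \<bar>?g z\<bar> \<le> \<bar>?g y\<bar>"
    using continuous_attains_sup[OF K(1)] \<open>x \<in> K\<close> by blast
  have y1: "\<bar>?g y\<bar> > 1" using y \<open>x \<in> K\<close> big by force
  have max: "\<bar>?g z\<bar> \<le> \<bar>?g y\<bar>" for z using y K(2) y1 by (cases "z \<in> K") force+
  have "y \<in> \<Omega>"
  proof (rule ccontr)
    assume "y \<notin> \<Omega>"
    then have "?g y = 0" by (simp add: opAadj_def zero)
    with y1 show False by simp
  qed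
  then have "y \<in> exch_X \<Omega> a p"
    using max y1 by (auto simp: exch_X_def local_max_in_def intro!: exI[of _ 1])
  then show ?thesis using max by blast
qed

section \<open>Optimal values, conjugate functions and semicontinuity\<close>

lemma Meas_mono: "\<Omega>' \<subseteq> \<Omega>'' \<Longrightarrow> Meas \<Omega> \<Omega>' \<subseteq> Meas \<Omega> \<Omega>''"
  unfolding Meas_def supported_in_def by blast

lemma Meas_self: "open \<Omega> \<Longrightarrow> is_smeasure \<Omega> \<nu> \<Longrightarrow> \<nu> \<in> Meas \<Omega> \<Omega>"
  by (auto simp: Meas_def supported_in_def is_smeasure_def intro!: bexI[of _ "- \<Omega>"])

lemma solves_P_imp_val_P: "solves_P \<Omega> a f \<Omega>' \<nu> \<Longrightarrow> val_P \<Omega> a f \<Omega>' = Jfun a f \<nu>"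
  unfolding solves_P_def val_P_def by (intro antisym INF_lower INF_greatest) auto

lemma solves_D_imp_val_D: "solves_D a f \<Omega>' p \<Longrightarrow> val_D a f \<Omega>' = - conj_fun f p"
  unfolding solves_D_def val_D_def by (intro antisym SUP_upper SUP_least) auto

lemma conj_fun_ge: "ereal (p \<bullet> y) - f y \<le> conj_fun f p"
  unfolding conj_fun_def by (rule SUP_upper) simp

text \<open>A real c strictly between B and \<open>f y0\<close> would eventually lie below every
  \<open>b n\<close>, hence below B. The bounds vary with n to accommodate J minus the norm.\<close>

lemma lsc_ext_tendsto_le:
  assumes "lsc_ext f" "y \<longlonglongrightarrow> y0" "b \<longlonglongrightarrow> B" "\<And>n. f (y n) \<le> ereal (b n)"
  shows "f y0 \<le> ereal B"
proof (rule ccontr)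
  assume "\<not> f y0 \<le> ereal B"
  then obtain c where c: "ereal B < ereal c" "ereal c < f y0" using ereal_dense2[of "ereal B"] by (auto simp: not_le)
  then have "\<forall>\<^sub>F z in nhds y0. ereal c < f z" using assms(1) by (simp add: lsc_ext_def)
  then have "\<forall>\<^sub>F n in sequentially. ereal c < f (y n)" using assms(2) by (rule eventually_compose_filterlim)
  then have "\<forall>\<^sub>F n in sequentially. c \<le> b n"
  proof eventually_elim
    case (elim n)
    then show ?case using assms(4)[of n] by (metis ereal_less_eq(3) less_imp_le order_trans)
  qed
  then have "c \<le> B" using tendsto_lowerbound[OF assms(3)] by simp
  with c show False by simp
qed

text \<open>Test the supremum in the conjugate with the unit vector in direction p. The maximum with
  0 covers p = 0.\<close>

lemma norm_le_of_conj_fun_le: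
  assumes "\<And>y. norm y \<le> 1 \<Longrightarrow> f y \<le> ereal B" "conj_fun f p \<le> ereal c"
  shows "norm p \<le> max 0 (B + c)"
proof (cases "p = 0")
  case False
  define y where "y = p /\<^sub>R norm p"
  have "p \<bullet> y = norm p" using False by (simp add: y_def dot_square_norm power2_eq_square)
  moreover have "norm y \<le> 1" using False by (simp add: y_def)
  ultimately have "ereal (norm p) - ereal B \<le> ereal (p \<bullet> y) - f y"
    using assms(1)[of y] by (intro ereal_minus_mono) auto
  also have "\<dots> \<le> conj_fun f p" by (rule conj_fun_ge)
  also have "\<dots> \<le> ereal c" by fact
  finally show ?thesis by simp
qed simp

section \<open>Monotone values, bounded iterates and limits of the algorithm\<close>

text \<open>The setting shared by (H1) and (H2), which enter afterwards through the boundedness of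
  \<open>range q\<close>.\<close>

locale exchange_algorithm =
  fixes \<Omega> :: "'a::euclidean_space set"
    and a :: "'m::finite \<Rightarrow> 'a \<Rightarrow> real"
    and f :: "real^'m \<Rightarrow> ereal"
    and Om :: "nat \<Rightarrow> 'a set"
    and \<mu> :: "nat \<Rightarrow> 'a smeasure"
    and q :: "nat \<Rightarrow> real^'m"
  assumes \<Omega>_open: "open \<Omega>"
    and a_C0: "\<And>i. a i \<in> C0 \<Omega>"
    and f_proper: "proper_fun f" and f_lsc: "lsc_ext f"
    and f_bdd: "\<exists>c::real. \<forall>y. ereal c \<le> f y"
    and OmSuc: "\<And>k. Om (Suc k) = Om k \<union> exch_X \<Omega> a (q k)"
    and \<mu>_sol: "\<And>k. solves_P \<Omega> a f (Om k) (\<mu> k)"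
    and q_sol: "\<And>k. solves_D a f (Om k) (q k)"
    and standing_\<Omega>: "standing \<Omega> a f \<Omega>"
    and standing_k: "\<And>k. standing \<Omega> a f (Om k)"
begin

lemma a_C0_UNIV: "a i \<in> C0 UNIV"
  by (rule C0_UNIV_I[OF \<Omega>_open a_C0])

lemma a_zero: "x \<notin> \<Omega> \<Longrightarrow> a i x = 0"
  using a_C0[of i] by (auto simp: C0_def)

lemma Om_mono: "j \<le> k \<Longrightarrow> Om j \<subseteq> Om k"
  by (rule lift_Suc_mono_le[of Om]) (auto simp: OmSuc)

lemma f_ge: obtains c :: real where "\<And>y. ereal c \<le> f y"
  using f_bdd by blast

lemma f_not_minf: "f y \<noteq> - \<infinity>"
  using f_proper by (simp add: proper_fun_def)

lemma tv_norm_nonneg: "0 \<le> tv_norm \<nu>"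
  by (simp add: tv_norm_def)

lemma Jfun_eq_conj: "Jfun a f (\<mu> k) = - conj_fun f (q k)"
  using standing_k[of k] solves_P_imp_val_P[OF \<mu>_sol[of k]] solves_D_imp_val_D[OF q_sol[of k]]
  by (simp add: standing_def)

definition J_val :: "nat \<Rightarrow> real" where "J_val k = real_of_ereal (Jfun a f (\<mu> k))"

text \<open>A point where f is finite keeps the conjugate above -\<infinity>, so by the absence of a
  gap J is below +\<infinity>; f never being -\<infinity> gives the other side.\<close>

lemma Jfun_eq_J_val: "Jfun a f (\<mu> k) = ereal (J_val k)"
proof -
  obtain y where "f y \<noteq> \<infinity>" using f_proper by (auto simp: proper_fun_def)
  then have "conj_fun f (q k) \<noteq> - \<infinity>"
    using conj_fun_ge[of "q k" y f] f_not_minf[of y] by (cases "f y") auto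
  then have "Jfun a f (\<mu> k) \<noteq> \<infinity>" unfolding Jfun_eq_conj by (simp add: ereal_uminus_eq_reorder)
  moreover have "Jfun a f (\<mu> k) \<noteq> - \<infinity>" using f_not_minf by (simp add: Jfun_def)
  ultimately show ?thesis by (cases "Jfun a f (\<mu> k)") (auto simp: J_val_def)
qed

lemma conj_fun_q: "conj_fun f (q k) = ereal (- J_val k)"
  using Jfun_eq_conj[of k] unfolding Jfun_eq_J_val by (metis ereal_uminus_uminus uminus_ereal.simps(1))

lemma f_opA: "f (opA a (\<mu> k)) = ereal (J_val k - tv_norm (\<mu> k))"
  using Jfun_eq_J_val[of k] by (cases "f (opA a (\<mu> k))") (auto simp: Jfun_def)

text \<open>The sets \<open>Om k\<close> grow, so \<open>\<mu> k\<close> competes in the next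
  problem.\<close>

lemma decseq_J_val: "decseq J_val"
proof (rule decseq_SucI)
  fix k
  have "\<mu> k \<in> Meas \<Omega> (Om (Suc k))"
    using \<mu>_sol[of k] Meas_mono[OF Om_mono[of k "Suc k"]] by (auto simp: solves_P_def)
  then have "Jfun a f (\<mu> (Suc k)) \<le> Jfun a f (\<mu> k)" using \<mu>_sol[of "Suc k"] by (simp add: solves_P_def)
  then show "J_val (Suc k) \<le> J_val k" by (simp add: Jfun_eq_J_val)
qed

text \<open>The norm is J minus f, where J is at most its initial value and f is at least c.\<close>

lemma tv_norm_bound: obtains C where "\<And>k. tv_norm (\<mu> k) \<le> C"
proof -
  obtain c where c: "\<And>y. ereal c \<le> f y" using f_ge by blast
  have "tv_norm (\<mu> k) \<le> J_val 0 - c" for k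
    using c[of "opA a (\<mu> k)"] decseqD[OF decseq_J_val, of 0 k] by (simp add: f_opA)
  then show thesis by (rule that)
qed

lemma J_val_ge: "(\<And>y. ereal c \<le> f y) \<Longrightarrow> c \<le> J_val k"
proof -
  assume "\<And>y. ereal c \<le> f y"
  from this[of "opA a (\<mu> k)"] show ?thesis using tv_norm_nonneg[of "\<mu> k"] by (simp add: f_opA)
qed

lemma is_smeasure_\<mu>: "is_smeasure \<Omega> (\<mu> k)"
  using \<mu>_sol[of k] by (simp add: solves_P_def Meas_def)

lemma val_P_le_J_val: "val_P \<Omega> a f \<Omega> \<le> ereal (J_val k)"
  using Meas_self[OF \<Omega>_open is_smeasure_\<mu>[of k]]
  unfolding val_P_def Jfun_eq_J_val[symmetric] by (rule INF_lower)

lemma q_bounded_if_bounded_on_ball: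
  assumes "\<And>y. norm y \<le> 1 \<Longrightarrow> f y \<le> ereal B"
  shows "bounded (range q)"
proof -
  obtain c where c: "\<And>y. ereal c \<le> f y" using f_ge by blast
  have "norm (q k) \<le> max 0 (B + - c)" for k
    using J_val_ge[OF c, of k] by (intro norm_le_of_conj_fun_le[OF assms]) (auto simp: conj_fun_q)
  then show ?thesis by (auto simp: bounded_iff)
qed

text \<open>Measures mapped to the unit vectors turn each coordinate of \<open>q k\<close> into an
  integral of the adjoint function over \<open>Om 0\<close>, where dual feasibility bounds it by
  1.\<close>

lemma q_bounded_if_opA_surj:
  assumes "\<forall>y. \<exists>\<nu> \<in> Meas \<Omega> (Om 0). opA a \<nu> = y"
  shows "bounded (range q)"
proof -
  have "\<forall>i. \<exists>\<nu>. \<nu> \<in> Meas \<Omega> (Om 0) \<and> opA a \<nu> = axis i 1" using assms by blast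
  then obtain \<nu> where \<nu>: "\<And>i. \<nu> i \<in> Meas \<Omega> (Om 0)" "\<And>i. opA a (\<nu> i) = axis i 1"
    by metis
  have "\<bar>q k $ i\<bar> \<le> tv_norm (\<nu> i)" for k i
  proof -
    have "q k $ i = q k \<bullet> opA a (\<nu> i)" by (simp add: \<nu>(2) inner_axis)
    also have "\<dots> = sintegral (opAadj a (q k)) (\<nu> i)"
      using \<nu>(1)[of i] a_C0_UNIV by (intro inner_opA[of \<Omega>]) (auto simp: Meas_def)
    finally show ?thesis
      using q_sol[of k] Om_mono[of 0 k]
      by (auto intro!: abs_sintegral_le_tv_norm[OF \<nu>(1) opAadj_C0_UNIV[OF a_C0_UNIV]] simp: solves_D_def feas_D_def)
  qed
  then have "norm (q k) \<le> (\<Sum>i\<in>UNIV. tv_norm (\<nu> i))" for k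
    using norm_le_l1_cart[of "q k"] by (meson order_trans sum_mono)
  then show ?thesis by (auto simp: bounded_iff)
qed

text \<open>The maximizer of \<open>\<bar>A\<^sup>*q\<^sub>k\<bar>\<close> is a constraint point for every later \<open>q\<^sub>l\<close>, so the infeasibility of \<open>q\<^sub>k\<close>
  is controlled by the distance to any later iterate.\<close>

lemma opAadj_q_le:
  assumes C: "\<And>p x. \<bar>opAadj a p x\<bar> \<le> C * norm p" and "k < l"
  shows "\<bar>opAadj a (q k) x\<bar> \<le> 1 + C * norm (q k - q l)"
proof (cases "\<bar>opAadj a (q k) x\<bar> > 1")
  case True
  then obtain y where y: "y \<in> exch_X \<Omega> a (q k)" "\<And>z. \<bar>opAadj a (q k) z\<bar> \<le> \<bar>opAadj a (q k) y\<bar>"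
    using exch_X_maximizer[of a \<Omega> "q k" x] a_C0_UNIV a_zero by blast
  have "y \<in> Om l" using y(1) Om_mono[of "Suc k" l] \<open>k < l\<close> by (auto simp: OmSuc)
  then have "\<bar>opAadj a (q l) y\<bar> \<le> 1" using q_sol[of l] by (auto simp: solves_D_def feas_D_def)
  then show ?thesis using y(2)[of x] C[of "q k - q l" y] by (simp add: opAadj_diff)
next
  case False
  then show ?thesis using C[of "q k - q l" x] by linarith
qed

text \<open>Starting from an arbitrary subsequence \<open>s\<close> makes the same extraction serve
  both the existence claim and the whole-sequence claims under uniqueness.\<close>

lemma convergent_subsequence:
  assumes bq: "bounded (range q)" and s: "strict_mono (s :: nat \<Rightarrow> nat)"
  obtains r \<mu>_lim q_lim where "strict_mono (r :: nat \<Rightarrow> nat)"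
    "weakstar_conv \<Omega> (\<mu> \<circ> (s \<circ> r)) \<mu>_lim" "(q \<circ> (s \<circ> r)) \<longlonglongrightarrow> q_lim"
    "solves_P \<Omega> a f \<Omega> \<mu>_lim" "solves_D a f \<Omega> q_lim"
    "(\<lambda>n. Jfun a f (\<mu> (s (r n)))) \<longlonglongrightarrow> Jfun a f \<mu>_lim" "Jfun a f \<mu>_lim = val_P \<Omega> a f \<Omega>"
proof -
  obtain C where "\<And>k. tv_norm (\<mu> k) \<le> C" using tv_norm_bound by blast
  then obtain r1 \<nu> m where r1: "strict_mono (r1 :: nat \<Rightarrow> nat)" and \<nu>: "is_smeasure \<Omega> \<nu>"
    "weakstar_conv \<Omega> ((\<lambda>k. \<mu> (s k)) \<circ> r1) \<nu>" and m: "(\<lambda>n. tv_norm (\<mu> (s (r1 n)))) \<longlonglongrightarrow> m" "tv_norm \<nu> \<le> m"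
    using smeasure_weakstar_subsequence[OF \<Omega>_open, of "\<lambda>k. \<mu> (s k)" C] is_smeasure_\<mu> by metis
  have "bounded (range (q \<circ> (s \<circ> r1)))" using bq by (rule bounded_subset) auto
  then obtain ql r2 where r2: "strict_mono (r2 :: nat \<Rightarrow> nat)" and ql: "((q \<circ> (s \<circ> r1)) \<circ> r2) \<longlonglongrightarrow> ql"
    using bounded_imp_convergent_subsequence by blast
  define r where "r = r1 \<circ> r2"
  define t where "t = s \<circ> r"
  have r: "strict_mono r" unfolding r_def by (rule strict_mono_o[OF r1 r2])
  have t: "strict_mono t" unfolding t_def by (rule strict_mono_o[OF s r])
  have qt: "(\<lambda>n. q (t n)) \<longlonglongrightarrow> ql" using ql by (simp add: comp_def t_def r_def)
  have wt: "weakstar_conv \<Omega> (\<mu> \<circ> t) \<nu>"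
    using \<nu>(2) LIMSEQ_subseq_LIMSEQ[OF _ r2] by (auto simp: weakstar_conv_def comp_def t_def r_def)
  have mt: "(\<lambda>n. tv_norm (\<mu> (t n))) \<longlonglongrightarrow> m"
    using LIMSEQ_subseq_LIMSEQ[OF m(1) r2] by (simp add: comp_def t_def r_def)

  obtain c where c: "\<And>y. ereal c \<le> f y" using f_ge by blast
  have "\<forall>k. c \<le> J_val k" using J_val_ge[OF c] by simp
  then obtain V where V: "J_val \<longlonglongrightarrow> V" by (rule decseq_convergent[OF decseq_J_val])
  have jt: "(\<lambda>n. J_val (t n)) \<longlonglongrightarrow> V" using LIMSEQ_subseq_LIMSEQ[OF V t] by (simp add: comp_def)
  have vle: "val_P \<Omega> a f \<Omega> \<le> ereal V"
    by (rule LIMSEQ_le_const[OF tendsto_ereal[OF V]]) (intro exI allI impI val_P_le_J_val)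

  \<comment> \<open>Compare each term with its successor in the subsequence: consecutive distances
    tend to 0, so the bound on the infeasibility disappears in the limit.\<close>
  have feas: "ql \<in> feas_D a \<Omega>"
    unfolding feas_D_def
  proof safe
    fix x
    obtain C where C: "\<And>p x. \<bar>opAadj a p x\<bar> \<le> C * norm p" using opAadj_bound[of a] a_C0_UNIV by blast
    have "(\<lambda>n. \<bar>opAadj a (q (t n)) x\<bar>) \<longlonglongrightarrow> \<bar>opAadj a ql x\<bar>"
      unfolding opAadj_def by (intro tendsto_intros qt)
    moreover have "(\<lambda>n. 1 + C * norm (q (t n) - q (t (Suc n)))) \<longlonglongrightarrow> 1 + C * norm (ql - ql)"
      by (intro tendsto_intros qt LIMSEQ_Suc[OF qt])
    moreover have "\<bar>opAadj a (q (t n)) x\<bar> \<le> 1 + C * norm (q (t n) - q (t (Suc n)))" for n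
      using t by (intro opAadj_q_le[OF C]) (simp add: strict_mono_Suc_iff)
    ultimately show "\<bar>opAadj a ql x\<bar> \<le> 1" using LIMSEQ_le by fastforce
  qed
  \<comment> \<open>Lower semicontinuity of the conjugate: for each fixed y the affine inequality
    passes to the limit, and the supremum over y is taken afterwards.\<close>
  have conj: "conj_fun f ql \<le> ereal (- V)"
    unfolding conj_fun_def
  proof (rule SUP_least)
    fix y
    show "ereal (ql \<bullet> y) - f y \<le> ereal (- V)"
    proof (cases "f y")
      case (real b)
      have "q k \<bullet> y - b \<le> - J_val k" for k
        using conj_fun_ge[of "q k" y f] by (simp add: real conj_fun_q)
      moreover have "(\<lambda>n. q (t n) \<bullet> y - b) \<longlonglongrightarrow> ql \<bullet> y - b" by (intro tendsto_intros qt)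
      moreover have "(\<lambda>n. - J_val (t n)) \<longlonglongrightarrow> - V" by (intro tendsto_intros jt)
      ultimately have "ql \<bullet> y - b \<le> - V" by (intro LIMSEQ_le[of "\<lambda>n. q (t n) \<bullet> y - b" _ "\<lambda>n. - J_val (t n)"]) auto
      then show ?thesis by (simp add: real)
    qed (use f_not_minf in auto)
  qed
  have "ereal V \<le> - conj_fun f ql" using conj by (cases "conj_fun f ql") auto
  moreover have "- conj_fun f ql \<le> val_D a f \<Omega>" unfolding val_D_def by (rule SUP_upper[OF feas])
  moreover have PD: "val_P \<Omega> a f \<Omega> = val_D a f \<Omega>" using standing_\<Omega> by (simp add: standing_def)
  \<comment> \<open>The chain V \<le> -f*(ql) \<le> sup(D) = inf(P) \<le> V closes, so all its terms
    agree.\<close>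
  ultimately have vV: "val_P \<Omega> a f \<Omega> = ereal V" "- conj_fun f ql = val_D a f \<Omega>" using vle by auto
  have "solves_D a f \<Omega> ql"
    unfolding solves_D_def vV(2) val_D_def using feas by (auto intro: SUP_upper)

  have "(\<lambda>n. opA a (\<mu> (t n))) \<longlonglongrightarrow> opA a \<nu>"
    using wt a_C0 unfolding weakstar_conv_def opA_def by (intro vec_tendstoI) (simp add: comp_def)
  \<comment> \<open>Along the subsequence f equals J minus the norm and tends to V - m. Since the
    norm of \<nu> is at most m, the possible loss of norm only lowers J.\<close>
  from lsc_ext_tendsto_le[OF f_lsc this tendsto_diff[OF jt mt]]
  have "f (opA a \<nu>) \<le> ereal (V - m)" by (simp add: f_opA)
  then have "Jfun a f \<nu> \<le> ereal m + ereal (V - m)"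
    unfolding Jfun_def using m(2) by (intro add_mono) auto
  then have "Jfun a f \<nu> \<le> val_P \<Omega> a f \<Omega>" by (simp add: vV(1))
  moreover have le: "val_P \<Omega> a f \<Omega> \<le> Jfun a f \<nu>'" if "\<nu>' \<in> Meas \<Omega> \<Omega>" for \<nu>'
    unfolding val_P_def by (rule INF_lower[OF that])
  ultimately have Jv: "Jfun a f \<nu> = val_P \<Omega> a f \<Omega>" using Meas_self[OF \<Omega>_open \<nu>(1)] by (intro antisym)
  have "solves_P \<Omega> a f \<Omega> \<nu>"
    unfolding solves_P_def Jv using Meas_self[OF \<Omega>_open \<nu>(1)] le by blast
  moreover have "(\<lambda>n. Jfun a f (\<mu> (s (r n)))) \<longlonglongrightarrow> Jfun a f \<nu>"
    using jt unfolding Jv vV(1) by (simp add: Jfun_eq_J_val t_def)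
  ultimately show thesis
    using that[OF r, of \<nu> ql] wt qt \<open>solves_D a f \<Omega> ql\<close> Jv by (simp add: t_def comp_def)
qed

end

section \<open>The alternatives (H1) and (H2), and convergence of whole sequences\<close>

theorem mainTheorem1:
  fixes \<Omega> \<Omega>0 :: "'a::euclidean_space set"
    and a :: "'m::finite \<Rightarrow> 'a \<Rightarrow> real"
    and f :: "real^'m \<Rightarrow> ereal"
    and Om :: "nat \<Rightarrow> 'a set"
    and \<mu> :: "nat \<Rightarrow> 'a smeasure"
    and q :: "nat \<Rightarrow> real^'m"
  assumes \<Omega>_open: "open \<Omega>" and \<Omega>_ne: "\<Omega> \<noteq> {}"
    and a_C0: "\<forall>i. a i \<in> C0 \<Omega>"
    and f_proper: "proper_fun f" and f_convex: "convex_ext f" and f_lsc: "lsc_ext f"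
    and f_bdd: "\<exists>c::real. \<forall>y. ereal c \<le> f y"
    and \<Omega>0_sub: "\<Omega>0 \<subseteq> \<Omega>"
    and Om0: "Om 0 = \<Omega>0"
    and OmSuc: "\<forall>k. Om (Suc k) = Om k \<union> exch_X \<Omega> a (q k)"
    and \<mu>_sol: "\<forall>k. solves_P \<Omega> a f (Om k) (\<mu> k)"
    and q_sol: "\<forall>k. solves_D a f (Om k) (q k)"
    and standing_\<Omega>: "standing \<Omega> a f \<Omega>"
    and standing_k: "\<forall>k. standing \<Omega> a f (Om k)"
    and H: "(\<exists>g :: real^'m \<Rightarrow> real^'m. \<exists>L::real. L > 0 \<and> (\<forall>y. f y \<noteq> \<infinity>) \<and>
               (\<forall>y. ((\<lambda>z. real_of_ereal (f z)) has_derivative (\<lambda>h. g y \<bullet> h)) (at y)) \<and>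
               (\<forall>y z. norm (g y - g z) \<le> L * norm (y - z)))
          \<or> (\<forall>y. \<exists>\<nu> \<in> Meas \<Omega> \<Omega>0. opA a \<nu> = y)"
  shows "(\<exists>r::nat \<Rightarrow> nat. \<exists>\<mu>_lim q_lim. strict_mono r \<and>
            weakstar_conv \<Omega> (\<mu> \<circ> r) \<mu>_lim \<and> (q \<circ> r) \<longlonglongrightarrow> q_lim \<and>
            solves_P \<Omega> a f \<Omega> \<mu>_lim \<and> solves_D a f \<Omega> q_lim \<and>
            (\<lambda>n. Jfun a f (\<mu> (r n))) \<longlonglongrightarrow> Jfun a f \<mu>_lim \<and>
            Jfun a f \<mu>_lim = val_P \<Omega> a f \<Omega>)
       \<and> (\<forall>\<mu>'. (\<forall>\<nu>. solves_P \<Omega> a f \<Omega> \<nu> \<longleftrightarrow> \<nu> = \<mu>') \<longrightarrow> weakstar_conv \<Omega> \<mu> \<mu>')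
       \<and> (\<forall>q'. (\<forall>p. solves_D a f \<Omega> p \<longleftrightarrow> p = q') \<longrightarrow> q \<longlonglongrightarrow> q')"
proof -
  interpret exchange_algorithm \<Omega> a f Om \<mu> q
    using assms by unfold_locales auto
  have bq: "bounded (range q)"
    using H
  proof
    assume "\<exists>g :: real^'m \<Rightarrow> real^'m. \<exists>L::real. L > 0 \<and> (\<forall>y. f y \<noteq> \<infinity>) \<and>
               (\<forall>y. ((\<lambda>z. real_of_ereal (f z)) has_derivative (\<lambda>h. g y \<bullet> h)) (at y)) \<and>
               (\<forall>y z. norm (g y - g z) \<le> L * norm (y - z))"
    then obtain g :: "real^'m \<Rightarrow> real^'m" where fin: "\<And>y. f y \<noteq> \<infinity>"
      and der: "\<And>y. ((\<lambda>z. real_of_ereal (f z)) has_derivative (\<lambda>h. g y \<bullet> h)) (at y)"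
      by blast
    \<comment> \<open>Under (H1) f is finite and continuous, hence bounded on the compact unit ball,
      which makes the conjugate coercive.\<close>
    have "continuous_on (cball 0 1) (\<lambda>z. real_of_ereal (f z))"
      using der by (intro continuous_at_imp_continuous_on ballI has_derivative_continuous)
    then have "bounded ((\<lambda>z. real_of_ereal (f z)) ` cball 0 1)"
      by (intro compact_imp_bounded compact_continuous_image compact_cball)
    then obtain B where B: "\<forall>y\<in>cball 0 1. \<bar>real_of_ereal (f y)\<bar> \<le> B" by (auto simp: bounded_iff)
    have "f y \<le> ereal B" if "norm y \<le> 1" for y
      using bspec[OF B, of y] that fin[of y] f_not_minf[of y] by (cases "f y") auto
    then show ?thesis by (rule q_bounded_if_bounded_on_ball)
  next
    assume "\<forall>y. \<exists>\<nu> \<in> Meas \<Omega> \<Omega>0. opA a \<nu> = y"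
    then show ?thesis by (intro q_bounded_if_opA_surj) (simp add: Om0)
  qed
  note sub = convergent_subsequence[OF bq]
  show ?thesis
  proof (intro conjI allI impI)
    have "strict_mono (id :: nat \<Rightarrow> nat)" by (simp add: strict_mono_def)
    then obtain r \<mu>_lim q_lim where "strict_mono (r :: nat \<Rightarrow> nat)"
      "weakstar_conv \<Omega> (\<mu> \<circ> (id \<circ> r)) \<mu>_lim" "(q \<circ> (id \<circ> r)) \<longlonglongrightarrow> q_lim"
      "solves_P \<Omega> a f \<Omega> \<mu>_lim" "solves_D a f \<Omega> q_lim"
      "(\<lambda>n. Jfun a f (\<mu> (id (r n)))) \<longlonglongrightarrow> Jfun a f \<mu>_lim" "Jfun a f \<mu>_lim = val_P \<Omega> a f \<Omega>"
      by (rule sub)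
    then show "\<exists>r::nat \<Rightarrow> nat. \<exists>\<mu>_lim q_lim. strict_mono r \<and>
            weakstar_conv \<Omega> (\<mu> \<circ> r) \<mu>_lim \<and> (q \<circ> r) \<longlonglongrightarrow> q_lim \<and>
            solves_P \<Omega> a f \<Omega> \<mu>_lim \<and> solves_D a f \<Omega> q_lim \<and>
            (\<lambda>n. Jfun a f (\<mu> (r n))) \<longlonglongrightarrow> Jfun a f \<mu>_lim \<and>
            Jfun a f \<mu>_lim = val_P \<Omega> a f \<Omega>"
      by (intro exI[of _ r] exI[of _ \<mu>_lim] exI[of _ q_lim]) simp
  next
    fix \<mu>' assume uniq: "\<forall>\<nu>. solves_P \<Omega> a f \<Omega> \<nu> \<longleftrightarrow> \<nu> = \<mu>'"
    show "weakstar_conv \<Omega> \<mu> \<mu>'"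
      unfolding weakstar_conv_def
    \<comment> \<open>The subsequence principle is applied to the real sequence of integrals of one
      test function at a time, so no metric for the weak-* topology enters.\<close>
    proof (intro ballI LIMSEQ_if_subseq_LIMSEQ)
      fix \<phi> and s :: "nat \<Rightarrow> nat" assume \<phi>: "\<phi> \<in> C0 \<Omega>" and s: "strict_mono s"
      obtain r \<nu> where "strict_mono (r :: nat \<Rightarrow> nat)" "weakstar_conv \<Omega> (\<mu> \<circ> (s \<circ> r)) \<nu>"
        "solves_P \<Omega> a f \<Omega> \<nu>"
        using s by (rule sub)
      moreover from this have "\<nu> = \<mu>'" using uniq by blast
      ultimately show "\<exists>r. strict_mono (r :: nat \<Rightarrow> nat) \<and> (\<lambda>n. sintegral \<phi> (\<mu> (s (r n)))) \<longlonglongrightarrow> sintegral \<phi> \<mu>'"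
        using \<phi> by (auto simp: weakstar_conv_def)
    qed
  next
    fix q' assume uniq: "\<forall>p. solves_D a f \<Omega> p \<longleftrightarrow> p = q'"
    show "q \<longlonglongrightarrow> q'"
    proof (rule LIMSEQ_if_subseq_LIMSEQ)
      fix s :: "nat \<Rightarrow> nat" assume s: "strict_mono s"
      obtain r p where "strict_mono (r :: nat \<Rightarrow> nat)" "(q \<circ> (s \<circ> r)) \<longlonglongrightarrow> p" "solves_D a f \<Omega> p"
        using s by (rule sub)
      with uniq show "\<exists>r. strict_mono (r :: nat \<Rightarrow> nat) \<and> (\<lambda>n. q (s (r n))) \<longlonglongrightarrow> q'"
        by (auto simp: comp_def)
    qed
  qed
qed

end
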